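(* Let $\mathcal{F}$ be a stably $2$-Calabi--Yau Frobenius extriangulated category with bifunctor $\mathbb{E}_{\mathcal{F}}$, and let $\mathcal{X}\subseteq\mathcal{F}$ be a functorially finite rigid subcategory. Then the full extension-closed subcategory \[\mathcal{X}^{\perp_1}=\{M\in\mathcal{F}:\ \mathbb{E}_{\mathcal{F}}(X,M)=0\text{ for all }X\in\mathcal{X}\}\] (with the extriangulated structure inherited from $\mathcal{F}$) is itself a stably $2$-Calabi--Yau Frobenius extriangulated category, and its cluster-tilting subcategories are precisely those cluster-tilting subcategories $\mathcal{T}$ of $\mathcal{F}$ such that $\mathcal{X}\subseteq\mathcal{T}$.
   Context: Let $\mathbb{K}$ be a field. A ($\mathbb{K}$-linear) extriangulated category in the sense of Nakaoka--Palu is a triple $(\mathcal{C},\mathbb{E}_{\mathcal{C}},\mathfrak{s})$: a $\mathbb{K}$-linear additive category $\mathcal{C}$, a $\mathbb{K}$-bilinear bifunctor $\mathbb{E}_{\mathcal{C}}\colon\mathcal{C}^{\mathrm{op}}\times\mathcal{C}\to\{\mathbb{K}\text{-modules}\}$, and an additive realisation $\mathfrak{s}$ assigning to each $\delta\in\mathbb{E}_{\mathcal{C}}(C,A)$ an equivalence class of sequences $A\xrightarrow{f}B\xrightarrow{g}C$ (equivalence: isomorphism which is the identity on $A$ and $C$), satisfying axioms (ET3), (ET3)$^{\mathrm{op}}$ (completion of commutative squares to morphisms of conflations) and (ET4), (ET4)$^{\mathrm{op}}$ (octahedral-type axioms). Sequences occurring in classes $\mathfrak{s}(\delta)$ are called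 conflations; the first map is an inflation, the second a deflation. Exact categories (with $\mathbb{E}=\mathrm{Ext}^1$) and triangulated categories (with $\mathbb{E}(C,A)=\mathrm{Hom}(C,\Sigma A)$) are examples. A full subcategory $\mathcal D\subseteq\mathcal C$ is extension-closed if $A,C\in\mathcal D$ implies $B\in\mathcal D$ for every conflation $A\to B\to C$; then $\mathcal D$ inherits an extriangulated structure by restricting $\mathbb{E}_{\mathcal{C}}$ and $\mathfrak{s}$. An object $P$ is projective if $\mathrm{Hom}(P,g)$ is surjective for every deflation $g$, and injective if $\mathrm{Hom}(f,P)$ is surjective for every inflation $f$. $\mathcal C$ has enough projectives if each $X$ admits a deflation $P\to X$ with $P$ projective; enough injectives is dual. $\mathcal C$ is Frobenius if it has enough projectives and injectives and these classes of objects coincide. The stable category $\underline{\mathcal{C}}$ of a Frobenius extriangulated category is its additive quotient by the ideal of morphisms factoring through projective-injectives; it is triangulated, with suspension $\Sigma$ obtained from conflations $X\to I\to\Sigma X$ with $I$ injective, and $\mathbb{E}_{\mathcal{C}}(X,Y)=\mathrm{Hom}_{\underline{\mathcal{C}}}(X,\Sigma Y)$. A Hom-finite $\mathbb{K}$-linear triangulated category $\mathcal{T}$ is $2$-Calabi--Yau if there is a functorial isomorphism $\mathrm{Ext}^1_{\mathcal{T}}(X,Y)\cong\mathrm{Hom}_{\mathbb{K}}(\mathrm{Ext}^1_{\mathcal{T}}(Y,X),\mathbb{K})$, where $\mathrm{Ext}^1_{\mathcal T}(X,Y)=\mathrm{Hom}_{\mathcal T}(X,\Sigma Y)$. A Frobenius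 extriangulated category is stably $2$-Calabi--Yau if it is $\mathbb{K}$-linear and its stable category is (Hom-finite and) $2$-Calabi--Yau. Subcategories are full. For a subcategory $\mathcal{X}\subseteq\mathcal{C}$, $\mathcal{X}^{\perp_1}=\{Y:\mathbb{E}_{\mathcal C}(X,Y)=0\ \forall X\in\mathcal{X}\}$ and ${}^{\perp_1}\mathcal{X}=\{Y:\mathbb{E}_{\mathcal C}(Y,X)=0\ \forall X\in\mathcal{X}\}$. $\mathcal{X}$ is rigid if $\mathcal{X}\subseteq\mathcal{X}^{\perp_1}$. $\mathcal{X}$ is functorially finite if every object has a right and a left $\mathcal{X}$-approximation (a right $\mathcal X$-approximation of $A$ is a morphism $X\to A$ with $X\in\mathcal{X}$ through which every morphism from an object of $\mathcal{X}$ to $A$ factors; left approximations are dual). A subcategory $\mathcal{T}$ is cluster-tilting if it is functorially finite and ${}^{\perp_1}\mathcal{T}=\mathcal{T}=\mathcal{T}^{\perp_1}$, where the perpendicular categories and functorial finiteness are taken in the ambient category under consideration. *)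

theory Defs
  imports "HOL-Algebra.Module" "HOL-Algebra.AbelCoset" "HOL-Library.FuncSet"
begin

section \<open>Linear algebra over a ring, with carriers\<close>

definition linear_map ::
  "'k ring \<Rightarrow> ('k, 'a) module \<Rightarrow> ('k, 'b) module \<Rightarrow> ('a \<Rightarrow> 'b) \<Rightarrow> bool" where
  "linear_map K M N h \<longleftrightarrow>
     h \<in> carrier M \<rightarrow> carrier N \<and>
     (\<forall>x\<in>carrier M. \<forall>y\<in>carrier M. h (x \<oplus>\<^bsub>M\<^esub> y) = h x \<oplus>\<^bsub>N\<^esub> h y) \<and>
     (\<forall>k\<in>carrier K. \<forall>x\<in>carrier M. h (k \<odot>\<^bsub>M\<^esub> x) = k \<odot>\<^bsub>N\<^esub> h x)"

definition linear_iso ::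
  "'k ring \<Rightarrow> ('k, 'a) module \<Rightarrow> ('k, 'b) module \<Rightarrow> ('a \<Rightarrow> 'b) \<Rightarrow> bool" where
  "linear_iso K M N h \<longleftrightarrow> linear_map K M N h \<and> bij_betw h (carrier M) (carrier N)"

definition finite_dimensional :: "'k ring \<Rightarrow> ('k, 'a) module \<Rightarrow> bool" where
  "finite_dimensional K M \<longleftrightarrow>
     (\<exists>B. finite B \<and> B \<subseteq> carrier M \<and>
        (\<forall>v\<in>carrier M. \<exists>a\<in>B \<rightarrow> carrier K. v = (\<Oplus>\<^bsub>M\<^esub>b\<in>B. a b \<odot>\<^bsub>M\<^esub> b)))"

text \<open>The record type of modules extends that of rings; its fields \<^const>\<open>mult\<close> and
  \<^const>\<open>one\<close> have no meaning for a module and are left unspecified below.\<close>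

definition self_module :: "'k ring \<Rightarrow> ('k, 'k) module" where
  "self_module K =
     \<lparr>carrier = carrier K, mult = mult K, one = one K, zero = zero K, add = add K,
      smult = mult K\<rparr>"

definition dual_module :: "'k ring \<Rightarrow> ('k, 'a) module \<Rightarrow> ('k, 'a \<Rightarrow> 'k) module" where
  "dual_module K M =
     \<lparr>carrier = {h \<in> extensional (carrier M). linear_map K M (self_module K) h},
      mult = undefined, one = undefined,
      zero = (\<lambda>x\<in>carrier M. \<zero>\<^bsub>K\<^esub>),
      add = (\<lambda>g h. \<lambda>x\<in>carrier M. g x \<oplus>\<^bsub>K\<^esub> h x),
      smult = (\<lambda>k h. \<lambda>x\<in>carrier M. k \<otimes>\<^bsub>K\<^esub> h x)\<rparr>"

definition quotient_module :: "('k, 'a) module \<Rightarrow> 'a set \<Rightarrow> ('k, 'a set) module" where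
  "quotient_module M I =
     \<lparr>carrier = a_rcosets\<^bsub>M\<^esub> I, mult = undefined, one = undefined,
      zero = I, add = set_add M,
      smult = (\<lambda>k S. \<Union>s\<in>S. I +>\<^bsub>M\<^esub> (k \<odot>\<^bsub>M\<^esub> s))\<rparr>"


section \<open>Linear and additive categories\<close>

text \<open>\<open>Cmp \<C> A B C g f\<close> is the composite of \<open>f : A \<rightarrow> B\<close> and \<open>g : B \<rightarrow> C\<close>. The composition is
  indexed by the three objects because distinct Hom-sets are not required to be disjoint.\<close>

record ('k, 'o, 'm) lincat =
  Obj :: "'o set"
  Mor :: "'o \<Rightarrow> 'o \<Rightarrow> ('k, 'm) module"
  Idt :: "'o \<Rightarrow> 'm"
  Cmp :: "'o \<Rightarrow> 'o \<Rightarrow> 'o \<Rightarrow> 'm \<Rightarrow> 'm \<Rightarrow> 'm"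

abbreviation Hom :: "('k, 'o, 'm, 'z) lincat_scheme \<Rightarrow> 'o \<Rightarrow> 'o \<Rightarrow> 'm set" where
  "Hom \<C> A B \<equiv> carrier (Mor \<C> A B)"

locale linear_category =
  fixes K :: "'k ring" and \<C> :: "('k, 'o, 'm, 'z) lincat_scheme"
  assumes field_K: "field K"
    and Mor_module: "\<lbrakk>A \<in> Obj \<C>; B \<in> Obj \<C>\<rbrakk> \<Longrightarrow> module K (Mor \<C> A B)"
    and Idt_in_Hom: "A \<in> Obj \<C> \<Longrightarrow> Idt \<C> A \<in> Hom \<C> A A"
    and Cmp_linear_left:
      "\<lbrakk>A \<in> Obj \<C>; B \<in> Obj \<C>; C \<in> Obj \<C>; f \<in> Hom \<C> A B\<rbrakk>
       \<Longrightarrow> linear_map K (Mor \<C> B C) (Mor \<C> A C) (\<lambda>g. Cmp \<C> A B C g f)"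
    and Cmp_linear_right:
      "\<lbrakk>A \<in> Obj \<C>; B \<in> Obj \<C>; C \<in> Obj \<C>; g \<in> Hom \<C> B C\<rbrakk>
       \<Longrightarrow> linear_map K (Mor \<C> A B) (Mor \<C> A C) (\<lambda>f. Cmp \<C> A B C g f)"
    and Cmp_Idt_right:
      "\<lbrakk>A \<in> Obj \<C>; B \<in> Obj \<C>; f \<in> Hom \<C> A B\<rbrakk> \<Longrightarrow> Cmp \<C> A A B f (Idt \<C> A) = f"
    and Cmp_Idt_left:
      "\<lbrakk>A \<in> Obj \<C>; B \<in> Obj \<C>; f \<in> Hom \<C> A B\<rbrakk> \<Longrightarrow> Cmp \<C> A B B (Idt \<C> B) f = f"
    and Cmp_assoc:
      "\<lbrakk>A \<in> Obj \<C>; B \<in> Obj \<C>; C \<in> Obj \<C>; D \<in> Obj \<C>;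
        f \<in> Hom \<C> A B; g \<in> Hom \<C> B C; h \<in> Hom \<C> C D\<rbrakk>
       \<Longrightarrow> Cmp \<C> A C D h (Cmp \<C> A B C g f) = Cmp \<C> A B D (Cmp \<C> B C D h g) f"

definition is_isomorphism ::
  "('k, 'o, 'm, 'z) lincat_scheme \<Rightarrow> 'o \<Rightarrow> 'o \<Rightarrow> 'm \<Rightarrow> bool" where
  "is_isomorphism \<C> A B f \<longleftrightarrow>
     f \<in> Hom \<C> A B \<and>
     (\<exists>g\<in>Hom \<C> B A. Cmp \<C> A B A g f = Idt \<C> A \<and> Cmp \<C> B A B f g = Idt \<C> B)"

definition is_zero_object :: "('k, 'o, 'm, 'z) lincat_scheme \<Rightarrow> 'o \<Rightarrow> bool" where
  "is_zero_object \<C> Z \<longleftrightarrow>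
     Z \<in> Obj \<C> \<and>
     (\<forall>A\<in>Obj \<C>. Hom \<C> A Z = {\<zero>\<^bsub>Mor \<C> A Z\<^esub>} \<and> Hom \<C> Z A = {\<zero>\<^bsub>Mor \<C> Z A\<^esub>})"

text \<open>\<open>S\<close> is a biproduct of \<open>A\<close> and \<open>B\<close> with inclusions \<open>i\<close>, \<open>j\<close> and projections \<open>p\<close>, \<open>q\<close>.\<close>

definition is_biproduct ::
  "('k, 'o, 'm, 'z) lincat_scheme \<Rightarrow> 'o \<Rightarrow> 'o \<Rightarrow> 'o \<Rightarrow> 'm \<Rightarrow> 'm \<Rightarrow> 'm \<Rightarrow> 'm \<Rightarrow> bool" where
  "is_biproduct \<C> A B S i j p q \<longleftrightarrow>
     A \<in> Obj \<C> \<and> B \<in> Obj \<C> \<and> S \<in> Obj \<C> \<and>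
     i \<in> Hom \<C> A S \<and> j \<in> Hom \<C> B S \<and> p \<in> Hom \<C> S A \<and> q \<in> Hom \<C> S B \<and>
     Cmp \<C> A S A p i = Idt \<C> A \<and> Cmp \<C> B S B q j = Idt \<C> B \<and>
     Cmp \<C> A S B q i = \<zero>\<^bsub>Mor \<C> A B\<^esub> \<and> Cmp \<C> B S A p j = \<zero>\<^bsub>Mor \<C> B A\<^esub> \<and>
     Cmp \<C> S A S i p \<oplus>\<^bsub>Mor \<C> S S\<^esub> Cmp \<C> S B S j q = Idt \<C> S"

locale additive_category = linear_category +
  assumes ex_zero_object: "\<exists>Z. is_zero_object \<C> Z"
    and ex_biproduct:
      "\<lbrakk>A \<in> Obj \<C>; B \<in> Obj \<C>\<rbrakk> \<Longrightarrow> \<exists>S i j p q. is_biproduct \<C> A B S i j p q"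


section \<open>Extriangulated categories\<close>

text \<open>For \<open>c : C' \<rightarrow> C\<close> and \<open>a : A \<rightarrow> A'\<close>, \<open>ExtMap \<C> C A C' A' c a\<close> is the map
  \<open>\<E>(c, a) : \<E>(C, A) \<rightarrow> \<E>(C', A')\<close>. For \<open>\<delta> \<in> \<E>(C, A)\<close>, \<open>Rlz \<C> C A \<delta>\<close> is the class
  \<open>\<s>(\<delta>)\<close>, a set of triples \<open>(f, B, g)\<close> standing for sequences \<open>A \<rightarrow> B \<rightarrow> C\<close>.\<close>

record ('k, 'o, 'm, 'e) extri = "('k, 'o, 'm) lincat" +
  Ext :: "'o \<Rightarrow> 'o \<Rightarrow> ('k, 'e) module"
  ExtMap :: "'o \<Rightarrow> 'o \<Rightarrow> 'o \<Rightarrow> 'o \<Rightarrow> 'm \<Rightarrow> 'm \<Rightarrow> 'e \<Rightarrow> 'e"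
  Rlz :: "'o \<Rightarrow> 'o \<Rightarrow> 'e \<Rightarrow> ('m \<times> 'o \<times> 'm) set"

text \<open>\<open>push \<C> C A A' a \<delta>\<close> is \<open>a\<^sub>*\<delta>\<close> for \<open>a : A \<rightarrow> A'\<close>, and \<open>pull \<C> C' C A c \<delta>\<close> is
  \<open>c\<^sup>*\<delta>\<close> for \<open>c : C' \<rightarrow> C\<close>, where \<open>\<delta> \<in> \<E>(C, A)\<close>.\<close>

definition push ::
  "('k, 'o, 'm, 'e) extri \<Rightarrow> 'o \<Rightarrow> 'o \<Rightarrow> 'o \<Rightarrow> 'm \<Rightarrow> 'e \<Rightarrow> 'e" where
  "push \<C> C A A' a \<delta> = ExtMap \<C> C A C A' (Idt \<C> C) a \<delta>"

definition pull ::
  "('k, 'o, 'm, 'e) extri \<Rightarrow> 'o \<Rightarrow> 'o \<Rightarrow> 'o \<Rightarrow> 'm \<Rightarrow> 'e \<Rightarrow> 'e" where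
  "pull \<C> C' C A c \<delta> = ExtMap \<C> C A C' A c (Idt \<C> A) \<delta>"

definition sequences ::
  "('k, 'o, 'm, 'e) extri \<Rightarrow> 'o \<Rightarrow> 'o \<Rightarrow> ('m \<times> 'o \<times> 'm) set" where
  "sequences \<C> A C = {(f, B, g). B \<in> Obj \<C> \<and> f \<in> Hom \<C> A B \<and> g \<in> Hom \<C> B C}"

fun equivalent_sequences ::
  "('k, 'o, 'm, 'e) extri \<Rightarrow> 'o \<Rightarrow> 'o \<Rightarrow> 'm \<times> 'o \<times> 'm \<Rightarrow> 'm \<times> 'o \<times> 'm \<Rightarrow> bool" where
  "equivalent_sequences \<C> A C (f, B, g) (f', B', g') \<longleftrightarrow>
     (\<exists>b. is_isomorphism \<C> B B' b \<and> Cmp \<C> A B B' b f = f' \<and> Cmp \<C> B B' C g' b = g)"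

text \<open>\<open>A \<rightarrow> B \<rightarrow> C\<close>, with maps \<open>f\<close> and \<open>g\<close>, realises \<open>\<delta> \<in> \<E>(C, A)\<close>.\<close>

definition realises ::
  "('k, 'o, 'm, 'e) extri \<Rightarrow> 'o \<Rightarrow> 'm \<Rightarrow> 'o \<Rightarrow> 'm \<Rightarrow> 'o \<Rightarrow> 'e \<Rightarrow> bool" where
  "realises \<C> A f B g C \<delta> \<longleftrightarrow>
     A \<in> Obj \<C> \<and> C \<in> Obj \<C> \<and> \<delta> \<in> carrier (Ext \<C> C A) \<and> (f, B, g) \<in> Rlz \<C> C A \<delta>"

definition conflation ::
  "('k, 'o, 'm, 'e) extri \<Rightarrow> 'o \<Rightarrow> 'm \<Rightarrow> 'o \<Rightarrow> 'm \<Rightarrow> 'o \<Rightarrow> bool" where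
  "conflation \<C> A f B g C \<longleftrightarrow> (\<exists>\<delta>. realises \<C> A f B g C \<delta>)"

definition inflation :: "('k, 'o, 'm, 'e) extri \<Rightarrow> 'o \<Rightarrow> 'o \<Rightarrow> 'm \<Rightarrow> bool" where
  "inflation \<C> A B f \<longleftrightarrow> (\<exists>g C. conflation \<C> A f B g C)"

definition deflation :: "('k, 'o, 'm, 'e) extri \<Rightarrow> 'o \<Rightarrow> 'o \<Rightarrow> 'm \<Rightarrow> bool" where
  "deflation \<C> B C g \<longleftrightarrow> (\<exists>A f. conflation \<C> A f B g C)"

text \<open>A morphism \<open>(a, c)\<close> from \<open>\<delta> \<in> \<E>(C, A)\<close> to \<open>\<delta>' \<in> \<E>(C', A')\<close>.\<close>

definition extension_morphism ::
  "('k, 'o, 'm, 'e) extri \<Rightarrow> 'o \<Rightarrow> 'o \<Rightarrow> 'e \<Rightarrow> 'o \<Rightarrow> 'o \<Rightarrow> 'e \<Rightarrow> 'm \<Rightarrow> 'm \<Rightarrow> bool" where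
  "extension_morphism \<C> C A \<delta> C' A' \<delta>' a c \<longleftrightarrow>
     a \<in> Hom \<C> A A' \<and> c \<in> Hom \<C> C C' \<and> push \<C> C A A' a \<delta> = pull \<C> C C' A' c \<delta>'"

locale extension_bifunctor = additive_category K \<C>
  for K :: "'k ring" and \<C> :: "('k, 'o, 'm, 'e) extri" +
  assumes Ext_module: "\<lbrakk>C \<in> Obj \<C>; A \<in> Obj \<C>\<rbrakk> \<Longrightarrow> module K (Ext \<C> C A)"
    and ExtMap_linear:
      "\<lbrakk>C \<in> Obj \<C>; A \<in> Obj \<C>; C' \<in> Obj \<C>; A' \<in> Obj \<C>; c \<in> Hom \<C> C' C; a \<in> Hom \<C> A A'\<rbrakk>
       \<Longrightarrow> linear_map K (Ext \<C> C A) (Ext \<C> C' A') (ExtMap \<C> C A C' A' c a)"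
    and ExtMap_linear_left:
      "\<lbrakk>C \<in> Obj \<C>; A \<in> Obj \<C>; C' \<in> Obj \<C>; A' \<in> Obj \<C>; a \<in> Hom \<C> A A'; \<delta> \<in> carrier (Ext \<C> C A)\<rbrakk>
       \<Longrightarrow> linear_map K (Mor \<C> C' C) (Ext \<C> C' A') (\<lambda>c. ExtMap \<C> C A C' A' c a \<delta>)"
    and ExtMap_linear_right:
      "\<lbrakk>C \<in> Obj \<C>; A \<in> Obj \<C>; C' \<in> Obj \<C>; A' \<in> Obj \<C>; c \<in> Hom \<C> C' C; \<delta> \<in> carrier (Ext \<C> C A)\<rbrakk>
       \<Longrightarrow> linear_map K (Mor \<C> A A') (Ext \<C> C' A') (\<lambda>a. ExtMap \<C> C A C' A' c a \<delta>)"
    and ExtMap_Idt: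
      "\<lbrakk>C \<in> Obj \<C>; A \<in> Obj \<C>; \<delta> \<in> carrier (Ext \<C> C A)\<rbrakk>
       \<Longrightarrow> ExtMap \<C> C A C A (Idt \<C> C) (Idt \<C> A) \<delta> = \<delta>"
    and ExtMap_Cmp:
      "\<lbrakk>C \<in> Obj \<C>; A \<in> Obj \<C>; C' \<in> Obj \<C>; A' \<in> Obj \<C>; C'' \<in> Obj \<C>; A'' \<in> Obj \<C>;
        c \<in> Hom \<C> C' C; c' \<in> Hom \<C> C'' C'; a \<in> Hom \<C> A A'; a' \<in> Hom \<C> A' A'';
        \<delta> \<in> carrier (Ext \<C> C A)\<rbrakk>
       \<Longrightarrow> ExtMap \<C> C A C'' A'' (Cmp \<C> C'' C' C c c') (Cmp \<C> A A' A'' a' a) \<delta> =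
           ExtMap \<C> C' A' C'' A'' c' a' (ExtMap \<C> C A C' A' c a \<delta>)"

text \<open>In \<open>realises_sum\<close> the extension
  \<open>\<E>(pC, iA)(\<delta>) + \<E>(qC, jA)(\<delta>')\<close> is \<open>\<delta> \<oplus> \<delta>' \<in> \<E>(C \<oplus> C', A \<oplus> A')\<close>, and the two maps of
  the sequence are \<open>f \<oplus> f'\<close> and \<open>g \<oplus> g'\<close>.\<close>

locale additive_realisation = extension_bifunctor +
  assumes Rlz_class:
      "\<lbrakk>C \<in> Obj \<C>; A \<in> Obj \<C>; \<delta> \<in> carrier (Ext \<C> C A)\<rbrakk>
       \<Longrightarrow> \<exists>s\<in>sequences \<C> A C.
             Rlz \<C> C A \<delta> = {t \<in> sequences \<C> A C. equivalent_sequences \<C> A C s t}"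
    and realises_morphism:
      "\<lbrakk>realises \<C> A f B g C \<delta>; realises \<C> A' f' B' g' C' \<delta>';
        extension_morphism \<C> C A \<delta> C' A' \<delta>' a c\<rbrakk>
       \<Longrightarrow> \<exists>b\<in>Hom \<C> B B'. Cmp \<C> A B B' b f = Cmp \<C> A A' B' f' a \<and>
                         Cmp \<C> B B' C' g' b = Cmp \<C> B C C' c g"
    and realises_split:
      "is_biproduct \<C> A C S i j p q \<Longrightarrow> realises \<C> A i S q C \<zero>\<^bsub>Ext \<C> C A\<^esub>"
    and realises_sum:
      "\<lbrakk>realises \<C> A f B g C \<delta>; realises \<C> A' f' B' g' C' \<delta>';
        is_biproduct \<C> A A' SA iA jA pA qA;
        is_biproduct \<C> B B' SB iB jB pB qB;
        is_biproduct \<C> C C' SC iC jC pC qC\<rbrakk>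
       \<Longrightarrow> realises \<C> SA
             (Cmp \<C> SA B SB iB (Cmp \<C> SA A B f pA)
                \<oplus>\<^bsub>Mor \<C> SA SB\<^esub> Cmp \<C> SA B' SB jB (Cmp \<C> SA A' B' f' qA))
             SB
             (Cmp \<C> SB C SC iC (Cmp \<C> SB B C g pB)
                \<oplus>\<^bsub>Mor \<C> SB SC\<^esub> Cmp \<C> SB C' SC jC (Cmp \<C> SB B' C' g' qB))
             SC
             (ExtMap \<C> C A SC SA pC iA \<delta> \<oplus>\<^bsub>Ext \<C> SC SA\<^esub> ExtMap \<C> C' A' SC SA qC jA \<delta>')"

locale extriangulated_category = additive_realisation +
  assumes ET3:
      "\<lbrakk>realises \<C> A f B g C \<delta>; realises \<C> A' f' B' g' C' \<delta>';
        a \<in> Hom \<C> A A'; b \<in> Hom \<C> B B'; Cmp \<C> A B B' b f = Cmp \<C> A A' B' f' a\<rbrakk>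
       \<Longrightarrow> \<exists>c. extension_morphism \<C> C A \<delta> C' A' \<delta>' a c \<and>
               Cmp \<C> B C C' c g = Cmp \<C> B B' C' g' b"
    and ET3_op:
      "\<lbrakk>realises \<C> A f B g C \<delta>; realises \<C> A' f' B' g' C' \<delta>';
        b \<in> Hom \<C> B B'; c \<in> Hom \<C> C C'; Cmp \<C> B C C' c g = Cmp \<C> B B' C' g' b\<rbrakk>
       \<Longrightarrow> \<exists>a. extension_morphism \<C> C A \<delta> C' A' \<delta>' a c \<and>
               Cmp \<C> A B B' b f = Cmp \<C> A A' B' f' a"
    and ET4:
      "\<lbrakk>realises \<C> A f B f' D \<delta>; realises \<C> B g C g' F \<delta>'\<rbrakk>
       \<Longrightarrow> \<exists>E d e h h' \<delta>''.
             d \<in> Hom \<C> D E \<and> e \<in> Hom \<C> E F \<and>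
             realises \<C> A h C h' E \<delta>'' \<and>
             h = Cmp \<C> A B C g f \<and>
             Cmp \<C> B C E h' g = Cmp \<C> B D E d f' \<and>
             Cmp \<C> C E F e h' = g' \<and>
             realises \<C> D d E e F (push \<C> F B D f' \<delta>') \<and>
             pull \<C> D E A d \<delta>'' = \<delta> \<and>
             push \<C> E A B f \<delta>'' = pull \<C> E F B e \<delta>'"
    and ET4_op:
      "\<lbrakk>realises \<C> D f' A f B \<delta>; realises \<C> F g' B g C \<delta>'\<rbrakk>
       \<Longrightarrow> \<exists>E d e h h' \<delta>''.
             d \<in> Hom \<C> D E \<and> e \<in> Hom \<C> E F \<and>
             realises \<C> E h' A h C \<delta>'' \<and>
             h = Cmp \<C> A B C g f \<and>
             Cmp \<C> D E A h' d = f' \<and>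
             Cmp \<C> E A B f h' = Cmp \<C> E F B g' e \<and>
             realises \<C> D d E e F (pull \<C> F B D g' \<delta>) \<and>
             push \<C> C E F e \<delta>'' = \<delta>' \<and>
             push \<C> B D E d \<delta> = pull \<C> B C E g \<delta>''"

definition extension_closed :: "('k, 'o, 'm, 'e) extri \<Rightarrow> 'o set \<Rightarrow> bool" where
  "extension_closed \<C> \<D> \<longleftrightarrow>
     \<D> \<subseteq> Obj \<C> \<and>
     (\<forall>A f B g C. conflation \<C> A f B g C \<and> A \<in> \<D> \<and> C \<in> \<D> \<longrightarrow> B \<in> \<D>)"

text \<open>The full subcategory on \<open>\<D>\<close> with the restrictions of \<open>\<E>\<close> and \<open>\<s>\<close>. If \<open>\<D>\<close> is
  extension-closed, the condition \<open>B \<in> \<D>\<close> holds automatically for \<open>A, C \<in> \<D>\<close>.\<close>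

definition full_sub :: "('k, 'o, 'm, 'e) extri \<Rightarrow> 'o set \<Rightarrow> ('k, 'o, 'm, 'e) extri" where
  "full_sub \<C> \<D> =
     \<C>\<lparr>Obj := \<D>, Rlz := (\<lambda>C A \<delta>. {(f, B, g) \<in> Rlz \<C> C A \<delta>. B \<in> \<D>})\<rparr>"


section \<open>Frobenius extriangulated categories and their stable categories\<close>

definition projective :: "('k, 'o, 'm, 'e) extri \<Rightarrow> 'o \<Rightarrow> bool" where
  "projective \<C> P \<longleftrightarrow>
     P \<in> Obj \<C> \<and>
     (\<forall>B C g. deflation \<C> B C g \<longrightarrow> (\<lambda>h. Cmp \<C> P B C g h) ` Hom \<C> P B = Hom \<C> P C)"

definition injective :: "('k, 'o, 'm, 'e) extri \<Rightarrow> 'o \<Rightarrow> bool" where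
  "injective \<C> I \<longleftrightarrow>
     I \<in> Obj \<C> \<and>
     (\<forall>A B f. inflation \<C> A B f \<longrightarrow> (\<lambda>h. Cmp \<C> A B I h f) ` Hom \<C> B I = Hom \<C> A I)"

locale frobenius_extriangulated_category = extriangulated_category +
  assumes enough_projectives: "X \<in> Obj \<C> \<Longrightarrow> \<exists>P g. projective \<C> P \<and> deflation \<C> P X g"
    and enough_injectives: "X \<in> Obj \<C> \<Longrightarrow> \<exists>I f. injective \<C> I \<and> inflation \<C> X I f"
    and projective_iff_injective: "projective \<C> P \<longleftrightarrow> injective \<C> P"

definition stable_ideal :: "('k, 'o, 'm, 'e) extri \<Rightarrow> 'o \<Rightarrow> 'o \<Rightarrow> 'm set" where
  "stable_ideal \<C> A B =
     {Cmp \<C> A P B v u | P u v.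
        projective \<C> P \<and> injective \<C> P \<and> u \<in> Hom \<C> A P \<and> v \<in> Hom \<C> P B}"

definition stable_category ::
  "('k, 'o, 'm, 'e) extri \<Rightarrow> ('k, 'o, 'm set) lincat" where
  "stable_category \<C> =
     \<lparr>Obj = Obj \<C>,
      Mor = (\<lambda>A B. quotient_module (Mor \<C> A B) (stable_ideal \<C> A B)),
      Idt = (\<lambda>A. stable_ideal \<C> A A +>\<^bsub>Mor \<C> A A\<^esub> Idt \<C> A),
      Cmp = (\<lambda>A B C G F. \<Union>g\<in>G. \<Union>f\<in>F. stable_ideal \<C> A C +>\<^bsub>Mor \<C> A C\<^esub> Cmp \<C> A B C g f)\<rparr>"

text \<open>The object part of a suspension: each \<open>X\<close> has a conflation \<open>X \<rightarrow> I \<rightarrow> S X\<close> with \<open>I\<close>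
  injective, realising the chosen extension \<open>\<sigma> X \<in> \<E>(S X, X)\<close>.\<close>

definition suspension ::
  "('k, 'o, 'm, 'e) extri \<Rightarrow> ('o \<Rightarrow> 'o) \<Rightarrow> ('o \<Rightarrow> 'e) \<Rightarrow> bool" where
  "suspension \<C> S \<sigma> \<longleftrightarrow>
     (\<forall>X\<in>Obj \<C>. \<exists>i I p. injective \<C> I \<and> realises \<C> X i I p (S X) (\<sigma> X))"

text \<open>The suspension of a stable morphism \<open>\<phi>\<close>: extend \<open>f \<in> \<phi>\<close> to a morphism \<open>(f, b, c)\<close> of
  conflations, from \<open>X \<rightarrow> I \<rightarrow> S X\<close> to \<open>Y \<rightarrow> J \<rightarrow> S Y\<close>, and take the stable class of \<open>c\<close>. A map
  \<open>b\<close> exists as soon as \<open>(f, c)\<close> is a morphism of extensions. The class does not depend on the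
  choices, and every map stably equal to such a \<open>c\<close> arises in the same way, so that the set of
  all such \<open>c\<close> is the stable morphism itself.\<close>

definition suspension_map ::
  "('k, 'o, 'm, 'e) extri \<Rightarrow> ('o \<Rightarrow> 'o) \<Rightarrow> ('o \<Rightarrow> 'e) \<Rightarrow> 'o \<Rightarrow> 'o \<Rightarrow> 'm set \<Rightarrow> 'm set" where
  "suspension_map \<C> S \<sigma> X Y \<phi> =
     {c. \<exists>f\<in>\<phi>. extension_morphism \<C> (S X) X (\<sigma> X) (S Y) Y (\<sigma> Y) f c}"

text \<open>For a triangulated category \<open>\<T>\<close> with suspension functor \<open>S\<close> (on morphisms: \<open>Sm\<close>),
  \<open>Ext\<^sup>1(X, Y)\<close> is \<open>Mor \<T> X (S Y)\<close>, and the map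
  \<open>Ext\<^sup>1(X, Y) \<rightarrow> Ext\<^sup>1(X', Y')\<close> induced by \<open>x : X' \<rightarrow> X\<close> and \<open>y : Y \<rightarrow> Y'\<close> sends
  \<open>\<epsilon>\<close> to \<open>S y \<circ> \<epsilon> \<circ> x\<close>.\<close>

definition ext1_map ::
  "('k, 'o, 'm) lincat \<Rightarrow> ('o \<Rightarrow> 'o) \<Rightarrow> ('o \<Rightarrow> 'o \<Rightarrow> 'm \<Rightarrow> 'm) \<Rightarrow>
   'o \<Rightarrow> 'o \<Rightarrow> 'o \<Rightarrow> 'o \<Rightarrow> 'm \<Rightarrow> 'm \<Rightarrow> 'm \<Rightarrow> 'm" where
  "ext1_map \<T> S Sm X Y X' Y' x y \<epsilon> =
     Cmp \<T> X' X (S Y') (Cmp \<T> X (S Y) (S Y') (Sm Y Y' y) \<epsilon>) x"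

definition two_calabi_yau ::
  "'k ring \<Rightarrow> ('k, 'o, 'm) lincat \<Rightarrow> ('o \<Rightarrow> 'o) \<Rightarrow> ('o \<Rightarrow> 'o \<Rightarrow> 'm \<Rightarrow> 'm) \<Rightarrow> bool" where
  "two_calabi_yau K \<T> S Sm \<longleftrightarrow>
     (\<forall>X\<in>Obj \<T>. \<forall>Y\<in>Obj \<T>. finite_dimensional K (Mor \<T> X Y)) \<and>
     (\<exists>\<eta>.
       (\<forall>X\<in>Obj \<T>. \<forall>Y\<in>Obj \<T>.
          linear_iso K (Mor \<T> X (S Y)) (dual_module K (Mor \<T> Y (S X))) (\<eta> X Y)) \<and>
       (\<forall>X\<in>Obj \<T>. \<forall>Y\<in>Obj \<T>. \<forall>X'\<in>Obj \<T>. \<forall>Y'\<in>Obj \<T>.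
          \<forall>x\<in>Hom \<T> X' X. \<forall>y\<in>Hom \<T> Y Y'. \<forall>\<epsilon>\<in>Hom \<T> X (S Y). \<forall>\<epsilon>'\<in>Hom \<T> Y' (S X').
            \<eta> X' Y' (ext1_map \<T> S Sm X Y X' Y' x y \<epsilon>) \<epsilon>' =
            \<eta> X Y \<epsilon> (ext1_map \<T> S Sm Y' X' Y X y x \<epsilon>')))"

text \<open>Any two suspension functors are naturally isomorphic, so the choice of \<open>S\<close> and \<open>\<sigma>\<close>
  does not matter.\<close>

definition stably_2CY_frobenius :: "'k ring \<Rightarrow> ('k, 'o, 'm, 'e) extri \<Rightarrow> bool" where
  "stably_2CY_frobenius K \<C> \<longleftrightarrow>
     frobenius_extriangulated_category K \<C> \<and>
     (\<exists>S \<sigma>. suspension \<C> S \<sigma> \<and>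
        two_calabi_yau K (stable_category \<C>) S (suspension_map \<C> S \<sigma>))"


section \<open>Cluster-tilting subcategories\<close>

text \<open>A full subcategory is given by its set of objects.\<close>

definition right_perp :: "('k, 'o, 'm, 'e) extri \<Rightarrow> 'o set \<Rightarrow> 'o set" where
  "right_perp \<C> \<X> = {Y \<in> Obj \<C>. \<forall>X\<in>\<X>. carrier (Ext \<C> X Y) = {\<zero>\<^bsub>Ext \<C> X Y\<^esub>}}"

definition left_perp :: "('k, 'o, 'm, 'e) extri \<Rightarrow> 'o set \<Rightarrow> 'o set" where
  "left_perp \<C> \<X> = {Y \<in> Obj \<C>. \<forall>X\<in>\<X>. carrier (Ext \<C> Y X) = {\<zero>\<^bsub>Ext \<C> Y X\<^esub>}}"

definition rigid :: "('k, 'o, 'm, 'e) extri \<Rightarrow> 'o set \<Rightarrow> bool" where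
  "rigid \<C> \<X> \<longleftrightarrow> \<X> \<subseteq> right_perp \<C> \<X>"

definition right_approximation ::
  "('k, 'o, 'm, 'e) extri \<Rightarrow> 'o set \<Rightarrow> 'o \<Rightarrow> 'o \<Rightarrow> 'm \<Rightarrow> bool" where
  "right_approximation \<C> \<X> X A r \<longleftrightarrow>
     X \<in> \<X> \<and> r \<in> Hom \<C> X A \<and>
     (\<forall>X'\<in>\<X>. \<forall>h\<in>Hom \<C> X' A. \<exists>k\<in>Hom \<C> X' X. h = Cmp \<C> X' X A r k)"

definition left_approximation ::
  "('k, 'o, 'm, 'e) extri \<Rightarrow> 'o set \<Rightarrow> 'o \<Rightarrow> 'o \<Rightarrow> 'm \<Rightarrow> bool" where
  "left_approximation \<C> \<X> A X l \<longleftrightarrow>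
     X \<in> \<X> \<and> l \<in> Hom \<C> A X \<and>
     (\<forall>X'\<in>\<X>. \<forall>h\<in>Hom \<C> A X'. \<exists>k\<in>Hom \<C> X X'. h = Cmp \<C> A X X' k l)"

definition functorially_finite :: "('k, 'o, 'm, 'e) extri \<Rightarrow> 'o set \<Rightarrow> bool" where
  "functorially_finite \<C> \<X> \<longleftrightarrow>
     \<X> \<subseteq> Obj \<C> \<and>
     (\<forall>A\<in>Obj \<C>. (\<exists>X r. right_approximation \<C> \<X> X A r) \<and>
                (\<exists>X l. left_approximation \<C> \<X> A X l))"

definition cluster_tilting :: "('k, 'o, 'm, 'e) extri \<Rightarrow> 'o set \<Rightarrow> bool" where
  "cluster_tilting \<C> \<T> \<longleftrightarrow>
     functorially_finite \<C> \<T> \<and> left_perp \<C> \<T> = \<T> \<and> right_perp \<C> \<T> = \<T>"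

end

theory Submission
  imports Defs
begin

text \<open>Write \<open>\<Z>\<close> for \<open>right_perp \<F> \<X>\<close>. Since \<open>Y \<rightarrow> I \<rightarrow> S Y\<close> induces a natural isomorphism
  from the stable morphisms \<open>X \<rightarrow> S Y\<close> to \<open>\<E>(X, Y)\<close>, the two-Calabi--Yau property is a natural duality between \<open>\<E>(X, Y)\<close>
  and \<open>\<E>(Y, X)\<close>. In this form it mentions neither the suspension nor the stable category, so it
  restricts to \<open>\<Z>\<close>; it also makes vanishing of \<open>\<E>\<close> symmetric, so that left and right perpendicular
  categories agree and projectives and injectives of \<open>\<Z>\<close> coincide. Pushing syzygy sequences out
  along left \<open>\<X>\<close>-approximations gives conflations \<open>X \<rightarrow> Z \<rightarrow> A\<close> with \<open>X \<in> \<X>\<close> and \<open>Z \<in> \<Z>\<close>, dually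
  \<open>A \<rightarrow> Z \<rightarrow> X\<close>. These yield approximations by \<open>\<Z>\<close>, hence functorial finiteness in \<open>\<F>\<close> of what is
  functorially finite in \<open>\<Z>\<close>, and, applied to syzygies, enough projectives in \<open>\<Z>\<close>.\<close>

section \<open>Linear algebra\<close>

text \<open>The obstacle is that \<Z> has more projectives than \<F>: the objects of \<X> become
  projective-injective in it. Hence a suspension of \<Z> is not the restriction of one of \<F>, and
  comparing the stable categories directly would mean relating two different suspensions. The
  functor \<E>, in contrast, is inherited unchanged, which is why the two-Calabi--Yau property is
  moved there first. Hom-finiteness is the part that still concerns stable morphisms: projectives of
  \<F> lie in \<Z> and remain projective, so the ideal only grows and stable Hom-spaces of \<Z> are
  quotients of those of \<F>.

  Stable morphisms are handled through representatives: a class with target \<open>S Y\<close> is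
  identified by the extension obtained by pulling back \<open>\<sigma> Y\<close>. The homological
  input consists of a few exact fragments of the long exact sequences, derived from (ET3), (ET4) and
  the realisation of split extensions. Their duals come from applying the same lemmas to the
  opposite category.\<close>

lemma linear_map_closed: "\<lbrakk>linear_map K M N h; x \<in> carrier M\<rbrakk> \<Longrightarrow> h x \<in> carrier N"
  by (auto simp: linear_map_def)

lemma linear_map_add:
  "\<lbrakk>linear_map K M N h; x \<in> carrier M; y \<in> carrier M\<rbrakk>
   \<Longrightarrow> h (x \<oplus>\<^bsub>M\<^esub> y) = h x \<oplus>\<^bsub>N\<^esub> h y"
  by (auto simp: linear_map_def)

lemma linear_map_smult:
  "\<lbrakk>linear_map K M N h; k \<in> carrier K; x \<in> carrier M\<rbrakk>
   \<Longrightarrow> h (k \<odot>\<^bsub>M\<^esub> x) = k \<odot>\<^bsub>N\<^esub> h x"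
  by (auto simp: linear_map_def)

lemma linear_map_zero:
  assumes "module K M" "module K N" "linear_map K M N h"
  shows "h \<zero>\<^bsub>M\<^esub> = \<zero>\<^bsub>N\<^esub>"
proof -
  interpret M: module K M by fact
  interpret N: module K N by fact
  have "h (\<zero>\<^bsub>K\<^esub> \<odot>\<^bsub>M\<^esub> \<zero>\<^bsub>M\<^esub>) = \<zero>\<^bsub>K\<^esub> \<odot>\<^bsub>N\<^esub> h \<zero>\<^bsub>M\<^esub>"
    by (rule linear_map_smult[OF assms(3)]) auto
  then show ?thesis
    using linear_map_closed[OF assms(3)] by simp
qed

lemma linear_map_minus:
  assumes "module K M" "module K N" "linear_map K M N h" "x \<in> carrier M"
  shows "h (\<ominus>\<^bsub>M\<^esub> x) = \<ominus>\<^bsub>N\<^esub> h x"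
proof -
  interpret M: module K M by fact
  interpret N: module K N by fact
  have "h (\<ominus>\<^bsub>M\<^esub> x) \<oplus>\<^bsub>N\<^esub> h x = \<zero>\<^bsub>N\<^esub>"
    using assms linear_map_add[OF assms(3), of "\<ominus>\<^bsub>M\<^esub> x" x] linear_map_zero[OF assms(1-3)]
    by (simp add: M.l_neg)
  then show ?thesis
    using assms(4) linear_map_closed[OF assms(3)] by (intro N.minus_equality[symmetric]) auto
qed

lemma linear_iso_linear: "linear_iso K M N h \<Longrightarrow> linear_map K M N h"
  by (simp add: linear_iso_def)

lemma linear_iso_inv_into:
  assumes "module K M" "linear_iso K M N h"
  shows "linear_iso K N M (inv_into (carrier M) h)"
proof -
  interpret M: module K M by fact
  let ?g = "inv_into (carrier M) h"
  have lin: "linear_map K M N h" and bij: "bij_betw h (carrier M) (carrier N)"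
    using assms(2) by (auto simp: linear_iso_def)
  have g: "?g y \<in> carrier M" "h (?g y) = y" if "y \<in> carrier N" for y
    using bij that by (auto simp: bij_betw_def inv_into_into f_inv_into_f)
  have gh: "?g (h x) = x" if "x \<in> carrier M" for x
    using bij that by (simp add: bij_betw_def)
  have "?g (x \<oplus>\<^bsub>N\<^esub> y) = ?g x \<oplus>\<^bsub>M\<^esub> ?g y" if "x \<in> carrier N" "y \<in> carrier N" for x y
    using gh[of "?g x \<oplus>\<^bsub>M\<^esub> ?g y"] linear_map_add[OF lin] g that by auto
  moreover have "?g (k \<odot>\<^bsub>N\<^esub> x) = k \<odot>\<^bsub>M\<^esub> ?g x" if "k \<in> carrier K" "x \<in> carrier N" for k x
    using gh[of "k \<odot>\<^bsub>M\<^esub> ?g x"] linear_map_smult[OF lin] g that by auto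
  ultimately show ?thesis
    using g bij_betw_inv_into[OF bij] by (auto simp: linear_iso_def linear_map_def)
qed

lemma linear_map_comp:
  "\<lbrakk>linear_map K M N f; linear_map K N L g\<rbrakk> \<Longrightarrow> linear_map K M L (\<lambda>x. g (f x))"
  by (fastforce simp: linear_map_def Pi_def)

lemma linear_iso_comp:
  "\<lbrakk>linear_iso K M N f; linear_iso K N L g\<rbrakk> \<Longrightarrow> linear_iso K M L (\<lambda>x. g (f x))"
  using linear_map_comp[of K M N f L g] bij_betw_trans[of f "carrier M" "carrier N" g "carrier L"]
  by (simp add: linear_iso_def comp_def)

lemma dual_module_carrier:
  "h \<in> carrier (dual_module K M) \<longleftrightarrow>
   h \<in> extensional (carrier M) \<and> linear_map K M (self_module K) h"
  by (simp add: dual_module_def)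

lemma linear_map_restrict:
  assumes "module K M" "linear_map K M N h"
  shows "linear_map K M N (restrict h (carrier M))"
proof -
  interpret module K M by fact
  show ?thesis using assms(2) by (auto simp: linear_map_def)
qed

text \<open>The inverse is precomposition with the inverse map. Both are restricted to the carrier
  because functionals in \<open>dual_module\<close> are extensional, so that equality of functions
  is equality of functionals.\<close>

lemma linear_iso_dual:
  assumes M: "module K M" and N: "module K N" and iso: "linear_iso K M N h"
  shows "linear_iso K (dual_module K N) (dual_module K M) (\<lambda>g. \<lambda>x\<in>carrier M. g (h x))"
proof -
  let ?D = "\<lambda>g. \<lambda>x\<in>carrier M. g (h x)"
  let ?E = "\<lambda>g. \<lambda>y\<in>carrier N. g (inv_into (carrier M) h y)"
  have lin: "linear_map K M N h" and bij: "bij_betw h (carrier M) (carrier N)"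
    using iso by (auto simp: linear_iso_def)
  have lin': "linear_map K N M (inv_into (carrier M) h)"
    by (rule linear_iso_linear[OF linear_iso_inv_into[OF M iso]])
  have D: "?D g \<in> carrier (dual_module K M)" if "g \<in> carrier (dual_module K N)" for g
    using that linear_map_restrict[OF M linear_map_comp[OF lin, of "self_module K" g]]
    by (simp add: dual_module_carrier)
  have E: "?E g \<in> carrier (dual_module K N)" if "g \<in> carrier (dual_module K M)" for g
    using that linear_map_restrict[OF N linear_map_comp[OF lin', of "self_module K" g]]
    by (simp add: dual_module_carrier)
  have DE: "?D (?E g) = g" if "g \<in> carrier (dual_module K M)" for g
    using that bij linear_map_closed[OF lin]
    by (auto simp: dual_module_carrier bij_betw_def intro!: extensionalityI[of _ "carrier M"])
  have ED: "?E (?D g) = g" if "g \<in> carrier (dual_module K N)" for g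
    using that bij linear_map_closed[OF lin']
    by (auto simp: dual_module_carrier bij_betw_def f_inv_into_f
        intro!: extensionalityI[of _ "carrier N"])
  have "bij_betw ?D (carrier (dual_module K N)) (carrier (dual_module K M))"
    by (rule bij_betw_byWitness[where f' = ?E]) (use D E DE ED in auto)
  moreover have "linear_map K (dual_module K N) (dual_module K M) ?D"
    using D linear_map_closed[OF lin]
    by (auto simp: linear_map_def) (auto simp: dual_module_def fun_eq_iff)
  ultimately show ?thesis by (simp add: linear_iso_def)
qed

text \<open>The dual of a zero module has a single element, and \<open>h\<close> is injective.
  Applied to a duality on \<E>, this makes vanishing of \<E> symmetric.\<close>

lemma linear_iso_zero_module:
  assumes "module K M" "module K N" "linear_iso K M (dual_module K N) h"
    and N: "carrier N = {\<zero>\<^bsub>N\<^esub>}"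
  shows "carrier M = {\<zero>\<^bsub>M\<^esub>}"
proof -
  interpret M: module K M by fact
  interpret N: module K N by fact
  have "g = (\<lambda>x\<in>carrier N. \<zero>\<^bsub>K\<^esub>)" if g: "g \<in> carrier (dual_module K N)" for g
  proof (rule extensionalityI[of _ "carrier N"])
    have lin: "linear_map K N (self_module K) g"
      using g by (simp add: dual_module_carrier)
    have "g (\<zero>\<^bsub>K\<^esub> \<odot>\<^bsub>N\<^esub> \<zero>\<^bsub>N\<^esub>) = \<zero>\<^bsub>K\<^esub> \<otimes>\<^bsub>K\<^esub> g \<zero>\<^bsub>N\<^esub>" "g \<zero>\<^bsub>N\<^esub> \<in> carrier K"
      using linear_map_smult[OF lin, of "\<zero>\<^bsub>K\<^esub>" "\<zero>\<^bsub>N\<^esub>"] linear_map_closed[OF lin, of "\<zero>\<^bsub>N\<^esub>"]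
      by (simp_all add: self_module_def)
    then show "g x = (\<lambda>x\<in>carrier N. \<zero>\<^bsub>K\<^esub>) x" if "x \<in> carrier N" for x
      using that N by simp
  qed (use g in \<open>auto simp: dual_module_carrier\<close>)
  moreover have "inj_on h (carrier M)" "h ` carrier M = carrier (dual_module K N)"
    using assms(3) by (auto simp: linear_iso_def bij_betw_def)
  ultimately have "x = \<zero>\<^bsub>M\<^esub>" if "x \<in> carrier M" for x
    using that M.zero_closed by (metis imageI inj_onD)
  then show ?thesis by auto
qed

section \<open>Submodules, spans and finite-dimensional images\<close>

lemma submodule_kernel:
  assumes "module K M" "module K N" "linear_map K M N h"
  shows "submodule {x \<in> carrier M. h x = \<zero>\<^bsub>N\<^esub>} K M"
proof -
  interpret M: module K M by fact
  interpret N: module K N by fact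
  show ?thesis
    by (rule M.submoduleI)
      (auto simp: linear_map_zero[OF assms] linear_map_minus[OF assms] linear_map_add[OF assms(3)]
        linear_map_smult[OF assms(3)])
qed

lemma submodule_vimage:
  assumes "module K M" "module K N" "linear_map K M N h" "submodule L K N"
  shows "submodule {x \<in> carrier M. h x \<in> L} K M"
proof -
  interpret M: module K M by fact
  interpret N: module K N by fact
  have "\<zero>\<^bsub>N\<^esub> \<in> L"
    using assms(4) subgroup.one_closed[OF submodule.axioms(1)] by fastforce
  then show ?thesis
    using N.submoduleE[OF assms(4)]
    by (intro M.submoduleI)
      (auto simp: linear_map_zero[OF assms(1-3)] linear_map_minus[OF assms(1-3)]
        linear_map_add[OF assms(3)] linear_map_smult[OF assms(3)])
qed

lemma (in module) submodule_linear_combination: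
  assumes "finite B" "B \<subseteq> L" "submodule L R M" "a \<in> B \<rightarrow> carrier R"
  shows "(\<Oplus>\<^bsub>M\<^esub>b\<in>B. a b \<odot>\<^bsub>M\<^esub> b) \<in> L"
  using assms(1,2,4)
proof (induction B)
  case empty
  then show ?case
    using subgroup.one_closed[OF submodule.axioms(1)[OF assms(3)]] by simp
next
  case (insert x F)
  have "L \<subseteq> carrier M" by (rule submoduleE(1)[OF assms(3)])
  then have "(\<Oplus>\<^bsub>M\<^esub>b\<in>insert x F. a b \<odot>\<^bsub>M\<^esub> b) = a x \<odot>\<^bsub>M\<^esub> x \<oplus>\<^bsub>M\<^esub> (\<Oplus>\<^bsub>M\<^esub>b\<in>F. a b \<odot>\<^bsub>M\<^esub> b)"
    using insert by (intro M.finsum_insert) (auto simp: Pi_def subset_iff)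
  with insert show ?case
    using submoduleE(4,5)[OF assms(3)] by auto
qed

lemma (in module) submodule_linear_combinations:
  assumes "finite B" "B \<subseteq> carrier M"
  shows "submodule {\<Oplus>\<^bsub>M\<^esub>b\<in>B. a b \<odot>\<^bsub>M\<^esub> b | a. a \<in> B \<rightarrow> carrier R} R M" (is "submodule ?L R M")
proof (rule submoduleI)
  have cl: "(\<lambda>b. a b \<odot>\<^bsub>M\<^esub> b) \<in> B \<rightarrow> carrier M" if "a \<in> B \<rightarrow> carrier R" for a
    using that assms by auto
  show "?L \<subseteq> carrier M"
    using cl by auto
  have "(\<Oplus>\<^bsub>M\<^esub>b\<in>B. \<zero> \<odot>\<^bsub>M\<^esub> b) = (\<Oplus>\<^bsub>M\<^esub>b\<in>B. \<zero>\<^bsub>M\<^esub>)"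
    by (rule M.finsum_cong') (use assms in auto)
  then show "\<zero>\<^bsub>M\<^esub> \<in> ?L"
    using M.finsum_zero by (intro CollectI exI[of _ "\<lambda>_. \<zero>"]) simp
  show sm: "k \<odot>\<^bsub>M\<^esub> x \<in> ?L" if k: "k \<in> carrier R" and x: "x \<in> ?L" for k x
  proof -
    obtain a where a: "a \<in> B \<rightarrow> carrier R" and x: "x = (\<Oplus>\<^bsub>M\<^esub>b\<in>B. a b \<odot>\<^bsub>M\<^esub> b)"
      using x by blast
    have "k \<odot>\<^bsub>M\<^esub> x = (\<Oplus>\<^bsub>M\<^esub>b\<in>B. (k \<otimes> a b) \<odot>\<^bsub>M\<^esub> b)"
      unfolding x using finsum_smult_ldistr[OF assms(1) k cl[OF a]] a k assms
      by (auto simp: Pi_def subset_iff smult_assoc1 intro: M.finsum_cong')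
    then show ?thesis using a k by (intro CollectI exI[of _ "\<lambda>b. k \<otimes> a b"]) auto
  qed
  show "x \<oplus>\<^bsub>M\<^esub> y \<in> ?L" if "x \<in> ?L" "y \<in> ?L" for x y
  proof -
    obtain a a' where a: "a \<in> B \<rightarrow> carrier R" "a' \<in> B \<rightarrow> carrier R"
      and xy: "x = (\<Oplus>\<^bsub>M\<^esub>b\<in>B. a b \<odot>\<^bsub>M\<^esub> b)" "y = (\<Oplus>\<^bsub>M\<^esub>b\<in>B. a' b \<odot>\<^bsub>M\<^esub> b)"
      using \<open>x \<in> ?L\<close> \<open>y \<in> ?L\<close> by blast
    have "x \<oplus>\<^bsub>M\<^esub> y = (\<Oplus>\<^bsub>M\<^esub>b\<in>B. (a b \<oplus> a' b) \<odot>\<^bsub>M\<^esub> b)"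
      unfolding xy M.finsum_addf[OF cl[OF a(1)] cl[OF a(2)], symmetric]
      by (rule M.finsum_cong') (use a assms in \<open>auto simp: Pi_def subset_iff smult_l_distr\<close>)
    then show ?thesis using a by (intro CollectI exI[of _ "\<lambda>b. a b \<oplus> a' b"]) auto
  qed
  fix x assume "x \<in> ?L"
  then have "x \<in> carrier M" "(\<ominus> \<one>) \<odot>\<^bsub>M\<^esub> x \<in> ?L"
    using \<open>?L \<subseteq> carrier M\<close> sm by auto
  then show "\<ominus>\<^bsub>M\<^esub> x \<in> ?L"
    by (simp add: smult_l_minus)
qed

lemma (in module) mem_linear_combinations:
  assumes "finite B" "B \<subseteq> carrier M" "v \<in> B"
  shows "\<exists>a\<in>B \<rightarrow> carrier R. v = (\<Oplus>\<^bsub>M\<^esub>b\<in>B. a b \<odot>\<^bsub>M\<^esub> b)"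
proof (rule bexI)
  have "(\<Oplus>\<^bsub>M\<^esub>b\<in>B. (if v = b then \<one> else \<zero>) \<odot>\<^bsub>M\<^esub> b) = (\<Oplus>\<^bsub>M\<^esub>b\<in>B. if v = b then b else \<zero>\<^bsub>M\<^esub>)"
    by (rule M.finsum_cong') (use assms in auto)
  also have "\<dots> = v"
    using assms by (intro M.add.finprod_singleton) auto
  finally show "v = (\<Oplus>\<^bsub>M\<^esub>b\<in>B. (if v = b then \<one> else \<zero>) \<odot>\<^bsub>M\<^esub> b)" ..
qed auto

lemma finite_dimensional_image:
  assumes M: "module K M" and N: "module K N" and h: "linear_map K M N h"
    and onto: "h ` carrier M = carrier N" and fd: "finite_dimensional K M"
  shows "finite_dimensional K N"
proof -
  interpret M: module K M by fact
  interpret N: module K N by fact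
  obtain B where B: "finite B" "B \<subseteq> carrier M"
    and span: "\<And>v. v \<in> carrier M \<Longrightarrow> \<exists>a\<in>B \<rightarrow> carrier K. v = (\<Oplus>\<^bsub>M\<^esub>b\<in>B. a b \<odot>\<^bsub>M\<^esub> b)"
    using fd unfolding finite_dimensional_def by blast
  have B': "finite (h ` B)" "h ` B \<subseteq> carrier N"
    using B onto by auto
  \<comment> \<open>The preimage of this span is a submodule containing \<open>B\<close>, hence all
    of \<open>M\<close>. Thus no linear combination has to be carried along \<open>h\<close>, which
    may identify elements of \<open>B\<close> and would force coefficients to be merged.\<close>
  let ?L = "{\<Oplus>\<^bsub>N\<^esub>b\<in>h ` B. a b \<odot>\<^bsub>N\<^esub> b | a. a \<in> h ` B \<rightarrow> carrier K}"
  have sub: "submodule {x \<in> carrier M. h x \<in> ?L} K M"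
    by (rule submodule_vimage[OF M N h N.submodule_linear_combinations[OF B']])
  have B2: "B \<subseteq> {x \<in> carrier M. h x \<in> ?L}"
    using B N.mem_linear_combinations[OF B'] by blast
  have "v \<in> {x \<in> carrier M. h x \<in> ?L}" if "v \<in> carrier M" for v
  proof -
    obtain a where "a \<in> B \<rightarrow> carrier K" "v = (\<Oplus>\<^bsub>M\<^esub>b\<in>B. a b \<odot>\<^bsub>M\<^esub> b)"
      using span[OF \<open>v \<in> carrier M\<close>] by blast
    then show ?thesis
      using M.submodule_linear_combination[OF B(1) B2 sub] by blast
  qed
  then have "h ` carrier M \<subseteq> ?L"
    by (intro image_subsetI) (simp only: mem_Collect_eq)
  then have "carrier N \<subseteq> ?L"
    by (simp only: onto)
  then show ?thesis
    unfolding finite_dimensional_def using B' by blast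
qed

section \<open>Quotient modules\<close>

locale module_quotient = module K M for K :: "'k ring" and M :: "('k, 'a) module" +
  fixes I
  assumes sub: "submodule I K M"
begin

sublocale abelian_subgroup I M
  by (rule abelian_subgroupI3)
    (use sub in \<open>auto simp: submodule_def additive_subgroup_def intro: M.abelian_group_axioms\<close>)

abbreviation cls :: "'a \<Rightarrow> 'a set" where "cls x \<equiv> I +>\<^bsub>M\<^esub> x"

lemma quotient_carrier: "carrier (quotient_module M I) = cls ` carrier M"
  by (auto simp: quotient_module_def A_RCOSETS_def')

lemma cls_eq_iff:
  assumes "x \<in> carrier M" "y \<in> carrier M"
  shows "cls x = cls y \<longleftrightarrow> x \<ominus>\<^bsub>M\<^esub> y \<in> I"
proof -
  have "x \<in> cls y \<longleftrightarrow> x \<ominus>\<^bsub>M\<^esub> y \<in> I"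
    using assms by (simp add: a_rcos_module a_minus_def)
  then show ?thesis
    using assms a_rcos_self[of x] a_repr_independence'[of x y] by auto
qed

lemma mem_cls_iff:
  assumes "x \<in> carrier M"
  shows "y \<in> cls x \<longleftrightarrow> y \<in> carrier M \<and> cls y = cls x"
  using assms by (metis a_elemrcos_carrier a_rcos_self a_repr_independence')

lemma quotient_add:
  "\<lbrakk>x \<in> carrier M; y \<in> carrier M\<rbrakk>
   \<Longrightarrow> cls x \<oplus>\<^bsub>quotient_module M I\<^esub> cls y = cls (x \<oplus>\<^bsub>M\<^esub> y)"
  by (simp add: quotient_module_def a_rcos_sum)

text \<open>Scalar multiplication on the quotient is a union over all representatives. Since
  \<open>I\<close> is closed under scalars, every member of that union is the same coset.\<close>

lemma quotient_smult:
  assumes "k \<in> carrier K" "x \<in> carrier M"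
  shows "k \<odot>\<^bsub>quotient_module M I\<^esub> cls x = cls (k \<odot>\<^bsub>M\<^esub> x)"
proof -
  have "cls (k \<odot>\<^bsub>M\<^esub> y) = cls (k \<odot>\<^bsub>M\<^esub> x)" if "y \<in> cls x" for y
  proof -
    have y: "y \<in> carrier M" "y \<ominus>\<^bsub>M\<^esub> x \<in> I"
      using that assms mem_cls_iff[of x y] cls_eq_iff[of y x] by blast+
    have "k \<odot>\<^bsub>M\<^esub> y \<ominus>\<^bsub>M\<^esub> k \<odot>\<^bsub>M\<^esub> x = k \<odot>\<^bsub>M\<^esub> (y \<ominus>\<^bsub>M\<^esub> x)"
      using assms y by (simp add: a_minus_def smult_r_distr smult_r_minus)
    then show ?thesis
      using assms y submodule.smult_closed[OF sub assms(1) y(2)] by (simp add: cls_eq_iff)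
  qed
  then have "(\<Union>y\<in>cls x. cls (k \<odot>\<^bsub>M\<^esub> y)) = (\<Union>y\<in>cls x. cls (k \<odot>\<^bsub>M\<^esub> x))"
    by (rule SUP_cong[OF refl])
  also have "\<dots> = cls (k \<odot>\<^bsub>M\<^esub> x)"
    using a_rcos_self[OF assms(2)] by blast
  finally show ?thesis by (simp add: quotient_module_def)
qed

lemma quotient_zero: "\<zero>\<^bsub>quotient_module M I\<^esub> = cls \<zero>\<^bsub>M\<^esub>"
  using a_subset by (simp add: quotient_module_def)

lemma quotient_is_module: "module K (quotient_module M I)"
proof (rule moduleI)
  show "cring K" ..
  show "abelian_group (quotient_module M I)"
  proof (rule abelian_groupI)
    fix S assume "S \<in> carrier (quotient_module M I)"
    then obtain x where "x \<in> carrier M" "S = cls x" by (auto simp: quotient_carrier)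
    then show "\<exists>T\<in>carrier (quotient_module M I). T \<oplus>\<^bsub>quotient_module M I\<^esub> S = \<zero>\<^bsub>quotient_module M I\<^esub>"
      by (intro bexI[of _ "cls (\<ominus>\<^bsub>M\<^esub> x)"])
        (auto simp: quotient_carrier quotient_add quotient_zero M.l_neg)
  qed (auto simp: quotient_carrier quotient_add quotient_zero M.a_ac)
qed (auto simp: quotient_carrier quotient_add quotient_smult smult_l_distr smult_r_distr
    smult_assoc1)

text \<open>A linear map killing \<open>I\<close> is constant on each coset, so its image of a coset
  is a singleton and \<open>the_elem\<close> reads off the induced value.\<close>

lemma quotient_universal:
  assumes N: "module K N" and h: "linear_map K M N h" and I: "\<And>x. x \<in> I \<Longrightarrow> h x = \<zero>\<^bsub>N\<^esub>"
  shows "linear_map K (quotient_module M I) N (\<lambda>S. the_elem (h ` S))"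
    and "\<And>x. x \<in> carrier M \<Longrightarrow> the_elem (h ` cls x) = h x"
proof -
  interpret N: module K N by fact
  have "h y = h x" if "x \<in> carrier M" "y \<in> cls x" for x y
  proof -
    have y: "y \<in> carrier M" "y \<ominus>\<^bsub>M\<^esub> x \<in> I"
      using that mem_cls_iff[of x y] cls_eq_iff[of y x] by blast+
    have "h y \<oplus>\<^bsub>N\<^esub> \<ominus>\<^bsub>N\<^esub> h x = \<zero>\<^bsub>N\<^esub>"
      using I[OF y(2)] y(1) that(1) linear_map_add[OF h, of y "\<ominus>\<^bsub>M\<^esub> x"]
        linear_map_minus[OF module_axioms N h, of x]
      by (simp add: a_minus_def)
    then show ?thesis
      using y(1) that(1) linear_map_closed[OF h] N.minus_equality[of "h y" "\<ominus>\<^bsub>N\<^esub> h x"]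
      by simp
  qed
  then have "h ` cls x = {h x}" if "x \<in> carrier M" for x
    using that a_rcos_self[OF that] by blast
  then show *: "\<And>x. x \<in> carrier M \<Longrightarrow> the_elem (h ` cls x) = h x"
    by simp
  show "linear_map K (quotient_module M I) N (\<lambda>S. the_elem (h ` S))"
    using h by (auto simp: linear_map_def quotient_carrier quotient_add quotient_smult *)
qed

lemma first_isomorphism:
  assumes N: "module K N" and h: "linear_map K M N h" and I: "\<And>x. x \<in> I \<longleftrightarrow> x \<in> carrier M \<and> h x = \<zero>\<^bsub>N\<^esub>"
    and onto: "h ` carrier M = carrier N"
  shows "linear_iso K (quotient_module M I) N (\<lambda>S. the_elem (h ` S))"
proof -
  interpret N: module K N by fact
  have vanish: "h x = \<zero>\<^bsub>N\<^esub>" if "x \<in> I" for x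
    using that I[of x] by blast
  note u = quotient_universal[OF N h vanish]
  have "inj_on (\<lambda>S. the_elem (h ` S)) (cls ` carrier M)"
  proof (rule inj_onI, elim imageE)
    fix S T x y
    assume "the_elem (h ` S) = the_elem (h ` T)" and xy: "S = cls x" "x \<in> carrier M"
      "T = cls y" "y \<in> carrier M"
    then have "h x = h y" by (simp add: u(2))
    then have "h (x \<ominus>\<^bsub>M\<^esub> y) = \<zero>\<^bsub>N\<^esub>"
      using xy linear_map_add[OF h] linear_map_minus[OF module_axioms N h] linear_map_closed[OF h]
      by (simp add: a_minus_def N.r_neg)
    then show "S = T"
      using xy by (simp add: cls_eq_iff I)
  qed
  moreover have "(\<lambda>S. the_elem (h ` S)) ` cls ` carrier M = carrier N"
    using onto by (simp add: image_image u(2))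
  ultimately show ?thesis
    using u(1) by (simp add: linear_iso_def bij_betw_def quotient_carrier)
qed

lemma linear_map_cls: "linear_map K M (quotient_module M I) cls"
  by (simp add: linear_map_def quotient_carrier quotient_add quotient_smult)

lemma cls_zero:
  assumes "x \<in> I"
  shows "cls x = \<zero>\<^bsub>quotient_module M I\<^esub>"
  using a_rcos_const[OF assms] by (simp add: quotient_module_def)

end

text \<open>The projection modulo \<open>J\<close> kills \<open>I\<close> and therefore induces a
  surjection between the quotients. It is meant for two stable ideals, that of \<F> inside that of
  its subcategory.\<close>

lemma finite_dimensional_coarser_quotient:
  assumes M: "module K M" and I: "submodule I K M" and J: "submodule J K M" and le: "I \<subseteq> J"
    and fd: "finite_dimensional K (quotient_module M I)"
  shows "finite_dimensional K (quotient_module M J)"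
proof -
  have I': "module_quotient K M I" and J': "module_quotient K M J"
    using M I J by (auto simp: module_quotient_def module_quotient_axioms_def)
  let ?p = "\<lambda>x. J +>\<^bsub>M\<^esub> x"
  have p: "?p x = \<zero>\<^bsub>quotient_module M J\<^esub>" if "x \<in> I" for x
    using that le module_quotient.cls_zero[OF J'] by blast
  note QI = module_quotient.quotient_is_module[OF I'] and QJ = module_quotient.quotient_is_module[OF J']
  note u = module_quotient.quotient_universal[OF I' QJ module_quotient.linear_map_cls[OF J'] p]
  have "(\<lambda>S. the_elem (?p ` S)) ` carrier (quotient_module M I) = carrier (quotient_module M J)"
    by (simp add: module_quotient.quotient_carrier[OF I'] module_quotient.quotient_carrier[OF J']
        image_image u(2))
  from finite_dimensional_image[OF QI QJ u(1) this fd] show ?thesis by simp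
qed

section \<open>Extriangulated categories\<close>

context linear_category
begin

lemma Cmp_closed:
  "\<lbrakk>A \<in> Obj \<C>; B \<in> Obj \<C>; C \<in> Obj \<C>; f \<in> Hom \<C> A B; g \<in> Hom \<C> B C\<rbrakk>
   \<Longrightarrow> Cmp \<C> A B C g f \<in> Hom \<C> A C"
  by (rule linear_map_closed[OF Cmp_linear_right])

lemma Cmp_zero_left:
  "\<lbrakk>A \<in> Obj \<C>; B \<in> Obj \<C>; C \<in> Obj \<C>; f \<in> Hom \<C> A B\<rbrakk>
   \<Longrightarrow> Cmp \<C> A B C \<zero>\<^bsub>Mor \<C> B C\<^esub> f = \<zero>\<^bsub>Mor \<C> A C\<^esub>"
  by (rule linear_map_zero[OF Mor_module Mor_module Cmp_linear_left])

lemma Cmp_zero_right: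
  "\<lbrakk>A \<in> Obj \<C>; B \<in> Obj \<C>; C \<in> Obj \<C>; g \<in> Hom \<C> B C\<rbrakk>
   \<Longrightarrow> Cmp \<C> A B C g \<zero>\<^bsub>Mor \<C> A B\<^esub> = \<zero>\<^bsub>Mor \<C> A C\<^esub>"
  by (rule linear_map_zero[OF Mor_module Mor_module Cmp_linear_right])

lemma zero_in_Hom: "\<lbrakk>A \<in> Obj \<C>; B \<in> Obj \<C>\<rbrakk> \<Longrightarrow> \<zero>\<^bsub>Mor \<C> A B\<^esub> \<in> Hom \<C> A B"
  by (rule abelian_monoid.zero_closed)
    (use Mor_module in \<open>auto simp: module_def abelian_group_def\<close>)

text \<open>Together with \<open>realises_split\<close> this supplies the trivial conflation 0 -> B
  -> B, used as a test object in (ET3) arguments.\<close>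

lemma is_biproduct_zero_left:
  assumes "is_zero_object \<C> Z" "B \<in> Obj \<C>"
  shows "is_biproduct \<C> Z B B \<zero>\<^bsub>Mor \<C> Z B\<^esub> (Idt \<C> B) \<zero>\<^bsub>Mor \<C> B Z\<^esub> (Idt \<C> B)"
proof -
  have Z: "Z \<in> Obj \<C>" using assms(1) by (simp add: is_zero_object_def)
  have "Idt \<C> Z = \<zero>\<^bsub>Mor \<C> Z Z\<^esub>"
    using assms(1) Idt_in_Hom[OF Z] Z by (auto simp: is_zero_object_def)
  moreover have "abelian_monoid (Mor \<C> B B)"
    using Mor_module[OF assms(2) assms(2)] by (simp add: module_def abelian_group_def)
  ultimately show ?thesis
    using assms(2) Z
    by (auto simp: is_biproduct_def zero_in_Hom Idt_in_Hom Cmp_zero_left Cmp_zero_right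
        Cmp_Idt_left Cmp_Idt_right abelian_monoid.l_zero)
qed

lemma is_isomorphism_inverse:
  assumes "is_isomorphism \<C> A B f"
  obtains g where "is_isomorphism \<C> B A g" "Cmp \<C> A B A g f = Idt \<C> A" "Cmp \<C> B A B f g = Idt \<C> B"
  using assms unfolding is_isomorphism_def by blast

lemma is_isomorphism_Idt: "A \<in> Obj \<C> \<Longrightarrow> is_isomorphism \<C> A A (Idt \<C> A)"
  by (auto simp: is_isomorphism_def Idt_in_Hom Cmp_Idt_left intro!: bexI[of _ "Idt \<C> A"])

end

context extension_bifunctor
begin

lemma equivalent_sequences_refl:
  "\<lbrakk>s \<in> sequences \<C> A C; A \<in> Obj \<C>; C \<in> Obj \<C>\<rbrakk> \<Longrightarrow> equivalent_sequences \<C> A C s s"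
  by (cases s, clarsimp simp: sequences_def)
    (meson Cmp_Idt_left Cmp_Idt_right is_isomorphism_Idt)

text \<open>Reversing arrows exchanges the two sequences in this relation. Symmetry is therefore
  what keeps \<s>(\<delta>) an equivalence class with the same representative in the opposite
  category.\<close>

lemma equivalent_sequences_sym:
  assumes "equivalent_sequences \<C> A C s t" "s \<in> sequences \<C> A C" "t \<in> sequences \<C> A C"
    and "A \<in> Obj \<C>" "C \<in> Obj \<C>"
  shows "equivalent_sequences \<C> A C t s"
proof -
  obtain f B g f' B' g' where s: "s = (f, B, g)" and t: "t = (f', B', g')"
    by (cases s; cases t)
  have B: "B \<in> Obj \<C>" "f \<in> Hom \<C> A B" "g \<in> Hom \<C> B C"
    and B': "B' \<in> Obj \<C>" "f' \<in> Hom \<C> A B'" "g' \<in> Hom \<C> B' C"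
    using assms(2,3) by (auto simp: s t sequences_def)
  obtain b where b: "is_isomorphism \<C> B B' b" "Cmp \<C> A B B' b f = f'" "Cmp \<C> B B' C g' b = g"
    using assms(1) by (auto simp: s t)
  then obtain c where c: "is_isomorphism \<C> B' B c" "Cmp \<C> B B' B c b = Idt \<C> B"
    "Cmp \<C> B' B B' b c = Idt \<C> B'"
    by (blast elim: is_isomorphism_inverse)
  have hom: "b \<in> Hom \<C> B B'" "c \<in> Hom \<C> B' B"
    using b(1) c(1) by (auto simp: is_isomorphism_def)
  have "Cmp \<C> A B' B c f' = f"
    using Cmp_assoc[of A B B' B f b c] b c hom B B' assms(4,5) by (simp add: Cmp_Idt_left)
  moreover have "Cmp \<C> B' B C g c = g'"
    using Cmp_assoc[of B' B B' C c b g'] b c hom B B' assms(4,5) by (simp add: Cmp_Idt_right)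
  ultimately show ?thesis
    using c(1) by (auto simp: s t)
qed

lemma pull_linear:
  assumes "C' \<in> Obj \<C>" "C \<in> Obj \<C>" "A \<in> Obj \<C>" "c \<in> Hom \<C> C' C"
  shows "linear_map K (Ext \<C> C A) (Ext \<C> C' A) (pull \<C> C' C A c)"
  unfolding pull_def using ExtMap_linear[OF assms(2,3,1,3,4) Idt_in_Hom[OF assms(3)]] by simp

lemma push_linear:
  assumes "C \<in> Obj \<C>" "A \<in> Obj \<C>" "A' \<in> Obj \<C>" "a \<in> Hom \<C> A A'"
  shows "linear_map K (Ext \<C> C A) (Ext \<C> C A') (push \<C> C A A' a)"
  unfolding push_def using ExtMap_linear[OF assms(1,2,1,3) Idt_in_Hom[OF assms(1)] assms(4)] by simp

lemma pull_linear_mor: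
  assumes "C' \<in> Obj \<C>" "C \<in> Obj \<C>" "A \<in> Obj \<C>" "\<delta> \<in> carrier (Ext \<C> C A)"
  shows "linear_map K (Mor \<C> C' C) (Ext \<C> C' A) (\<lambda>c. pull \<C> C' C A c \<delta>)"
  unfolding pull_def using ExtMap_linear_left[OF assms(2,3,1,3) Idt_in_Hom[OF assms(3)] assms(4)] .

lemmas pull_closed = linear_map_closed[OF pull_linear]
lemmas push_closed = linear_map_closed[OF push_linear]

lemma pull_zero:
  "\<lbrakk>C' \<in> Obj \<C>; C \<in> Obj \<C>; A \<in> Obj \<C>; c \<in> Hom \<C> C' C\<rbrakk>
   \<Longrightarrow> pull \<C> C' C A c \<zero>\<^bsub>Ext \<C> C A\<^esub> = \<zero>\<^bsub>Ext \<C> C' A\<^esub>"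
  by (rule linear_map_zero[OF Ext_module Ext_module pull_linear])

lemma push_zero:
  "\<lbrakk>C \<in> Obj \<C>; A \<in> Obj \<C>; A' \<in> Obj \<C>; a \<in> Hom \<C> A A'\<rbrakk>
   \<Longrightarrow> push \<C> C A A' a \<zero>\<^bsub>Ext \<C> C A\<^esub> = \<zero>\<^bsub>Ext \<C> C A'\<^esub>"
  by (rule linear_map_zero[OF Ext_module Ext_module push_linear])

lemma pull_Idt: "\<lbrakk>C \<in> Obj \<C>; A \<in> Obj \<C>; \<delta> \<in> carrier (Ext \<C> C A)\<rbrakk> \<Longrightarrow> pull \<C> C C A (Idt \<C> C) \<delta> = \<delta>"
  by (simp add: pull_def ExtMap_Idt)

lemma push_Idt: "\<lbrakk>C \<in> Obj \<C>; A \<in> Obj \<C>; \<delta> \<in> carrier (Ext \<C> C A)\<rbrakk> \<Longrightarrow> push \<C> C A A (Idt \<C> A) \<delta> = \<delta>"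
  by (simp add: push_def ExtMap_Idt)

lemma pull_Cmp:
  "\<lbrakk>C'' \<in> Obj \<C>; C' \<in> Obj \<C>; C \<in> Obj \<C>; A \<in> Obj \<C>; c' \<in> Hom \<C> C'' C'; c \<in> Hom \<C> C' C;
    \<delta> \<in> carrier (Ext \<C> C A)\<rbrakk>
   \<Longrightarrow> pull \<C> C'' C A (Cmp \<C> C'' C' C c c') \<delta> = pull \<C> C'' C' A c' (pull \<C> C' C A c \<delta>)"
  unfolding pull_def
  using ExtMap_Cmp[of C A C' A C'' A c c' "Idt \<C> A" "Idt \<C> A"] by (simp add: Idt_in_Hom Cmp_Idt_left)

lemma push_Cmp:
  "\<lbrakk>C \<in> Obj \<C>; A \<in> Obj \<C>; A' \<in> Obj \<C>; A'' \<in> Obj \<C>; a \<in> Hom \<C> A A'; a' \<in> Hom \<C> A' A'';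
    \<delta> \<in> carrier (Ext \<C> C A)\<rbrakk>
   \<Longrightarrow> push \<C> C A A'' (Cmp \<C> A A' A'' a' a) \<delta> = push \<C> C A' A'' a' (push \<C> C A A' a \<delta>)"
  unfolding push_def
  using ExtMap_Cmp[of C A C A' C A'' "Idt \<C> C" "Idt \<C> C" a a'] by (simp add: Idt_in_Hom Cmp_Idt_left)

lemma ExtMap_push_pull:
  "\<lbrakk>C' \<in> Obj \<C>; C \<in> Obj \<C>; A \<in> Obj \<C>; A' \<in> Obj \<C>; c \<in> Hom \<C> C' C; a \<in> Hom \<C> A A';
    \<delta> \<in> carrier (Ext \<C> C A)\<rbrakk>
   \<Longrightarrow> ExtMap \<C> C A C' A' c a \<delta> = push \<C> C' A A' a (pull \<C> C' C A c \<delta>)"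
  unfolding push_def pull_def
  using ExtMap_Cmp[of C A C' A C' A' c "Idt \<C> C'" "Idt \<C> A" a]
  by (simp add: Idt_in_Hom Cmp_Idt_left Cmp_Idt_right)

lemma pull_push:
  "\<lbrakk>C' \<in> Obj \<C>; C \<in> Obj \<C>; A \<in> Obj \<C>; A' \<in> Obj \<C>; c \<in> Hom \<C> C' C; a \<in> Hom \<C> A A';
    \<delta> \<in> carrier (Ext \<C> C A)\<rbrakk>
   \<Longrightarrow> pull \<C> C' C A' c (push \<C> C A A' a \<delta>) = push \<C> C' A A' a (pull \<C> C' C A c \<delta>)"
  unfolding push_def pull_def
  using ExtMap_Cmp[of C A C' A C' A' c "Idt \<C> C'" "Idt \<C> A" a]
    ExtMap_Cmp[of C A C A' C' A' "Idt \<C> C" c a "Idt \<C> A'"]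
  by (simp add: Idt_in_Hom Cmp_Idt_left Cmp_Idt_right)

end

context additive_realisation
begin

lemma realisesD:
  assumes "realises \<C> A f B g C \<delta>"
  shows "A \<in> Obj \<C>" "B \<in> Obj \<C>" "C \<in> Obj \<C>" "f \<in> Hom \<C> A B" "g \<in> Hom \<C> B C"
    "\<delta> \<in> carrier (Ext \<C> C A)"
  using assms Rlz_class[of C A \<delta>] by (auto simp: realises_def sequences_def)

lemma ex_realisation:
  assumes "C \<in> Obj \<C>" "A \<in> Obj \<C>" "\<delta> \<in> carrier (Ext \<C> C A)"
  shows "\<exists>f B g. realises \<C> A f B g C \<delta>"
proof -
  obtain s where "s \<in> sequences \<C> A C"
    "Rlz \<C> C A \<delta> = {t \<in> sequences \<C> A C. equivalent_sequences \<C> A C s t}"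
    using Rlz_class[OF assms] by blast
  then have "s \<in> Rlz \<C> C A \<delta>"
    using equivalent_sequences_refl assms by simp
  then show ?thesis
    using assms by (cases s) (auto simp: realises_def)
qed

end

section \<open>The opposite category\<close>

text \<open>Reversal exchanges push-outs with pull-backs, inflations with deflations, projectives
  with injectives and left with right perpendicular categories. Once the axioms are checked here,
  dual results are obtained by instantiation.\<close>

definition opposite :: "('k, 'o, 'm, 'e) extri \<Rightarrow> ('k, 'o, 'm, 'e) extri" where
  "opposite \<C> = \<C>\<lparr>
     Mor := (\<lambda>A B. Mor \<C> B A),
     Cmp := (\<lambda>A B C g f. Cmp \<C> C B A f g),
     Ext := (\<lambda>C A. Ext \<C> A C),
     ExtMap := (\<lambda>C A C' A' c a. ExtMap \<C> A C A' C' a c),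
     Rlz := (\<lambda>C A \<delta>. {(f, B, g). (g, B, f) \<in> Rlz \<C> A C \<delta>})\<rparr>"

lemma opposite_simps [simp]:
  "Obj (opposite \<C>) = Obj \<C>"
  "Mor (opposite \<C>) A B = Mor \<C> B A"
  "Idt (opposite \<C>) = Idt \<C>"
  "Cmp (opposite \<C>) A B C g f = Cmp \<C> C B A f g"
  "Ext (opposite \<C>) C A = Ext \<C> A C"
  "ExtMap (opposite \<C>) C A C' A' c a = ExtMap \<C> A C A' C' a c"
  "(f, B, g) \<in> Rlz (opposite \<C>) C A \<delta> \<longleftrightarrow> (g, B, f) \<in> Rlz \<C> A C \<delta>"
  by (simp_all add: opposite_def)

lemma push_opposite [simp]: "push (opposite \<C>) C A A' a = pull \<C> A' A C a"
  by (simp add: fun_eq_iff push_def pull_def)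

lemma pull_opposite [simp]: "pull (opposite \<C>) C' C A c = push \<C> A C C' c"
  by (simp add: fun_eq_iff push_def pull_def)

lemma realises_opposite [simp]:
  "realises (opposite \<C>) A f B g C \<delta> \<longleftrightarrow> realises \<C> C g B f A \<delta>"
  by (auto simp: realises_def)

lemma conflation_opposite [simp]: "conflation (opposite \<C>) A f B g C \<longleftrightarrow> conflation \<C> C g B f A"
  by (simp add: conflation_def)

lemma inflation_opposite [simp]: "inflation (opposite \<C>) A B f \<longleftrightarrow> deflation \<C> B A f"
  by (auto simp: inflation_def deflation_def)

lemma deflation_opposite [simp]: "deflation (opposite \<C>) B C f \<longleftrightarrow> inflation \<C> C B f"
  by (auto simp: inflation_def deflation_def)

lemma extension_morphism_opposite [simp]:
  "extension_morphism (opposite \<C>) C A \<delta> C' A' \<delta>' a c \<longleftrightarrow>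
   extension_morphism \<C> A' C' \<delta>' A C \<delta> c a"
  by (auto simp: extension_morphism_def)

lemma is_isomorphism_opposite [simp]: "is_isomorphism (opposite \<C>) A B f \<longleftrightarrow> is_isomorphism \<C> B A f"
  by (auto simp: is_isomorphism_def)

lemma is_zero_object_opposite [simp]: "is_zero_object (opposite \<C>) Z \<longleftrightarrow> is_zero_object \<C> Z"
  by (auto simp: is_zero_object_def)

lemma is_biproduct_opposite [simp]:
  "is_biproduct (opposite \<C>) A B S i j p q \<longleftrightarrow> is_biproduct \<C> A B S p q i j"
  by (auto simp: is_biproduct_def)

lemma sequences_opposite:
  "(f, B, g) \<in> sequences (opposite \<C>) A C \<longleftrightarrow> (g, B, f) \<in> sequences \<C> C A"
  by (auto simp: sequences_def)

lemma equivalent_sequences_opposite: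
  "equivalent_sequences (opposite \<C>) A C (f, B, g) (f', B', g') \<longleftrightarrow>
   equivalent_sequences \<C> C A (g', B', f') (g, B, f)"
  by auto

lemma linear_category_opposite:
  fixes \<C> :: "('k, 'o, 'm, 'e) extri"
  assumes "linear_category K \<C>"
  shows "linear_category K (opposite \<C>)"
proof -
  interpret linear_category K \<C> by fact
  show ?thesis
    by (rule linear_category.intro)
      (simp_all add: field_K Mor_module Idt_in_Hom Cmp_linear_left Cmp_linear_right Cmp_Idt_right
        Cmp_Idt_left Cmp_assoc)
qed

lemma additive_category_opposite:
  fixes \<C> :: "('k, 'o, 'm, 'e) extri"
  assumes "additive_category K \<C>"
  shows "additive_category K (opposite \<C>)"
proof -
  interpret additive_category K \<C> by fact
  interpret op: linear_category K "opposite \<C>"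
    by (rule linear_category_opposite) unfold_locales
  show ?thesis
    by unfold_locales (use ex_zero_object ex_biproduct in \<open>simp_all, blast\<close>)
qed

lemma extension_bifunctor_opposite:
  assumes "extension_bifunctor K \<C>"
  shows "extension_bifunctor K (opposite \<C>)"
proof -
  interpret extension_bifunctor K \<C> by fact
  interpret op: additive_category K "opposite \<C>"
    by (rule additive_category_opposite) unfold_locales
  show ?thesis
    by (intro extension_bifunctor.intro op.additive_category_axioms extension_bifunctor_axioms.intro)
      (simp_all add: Ext_module ExtMap_linear ExtMap_linear_left ExtMap_linear_right ExtMap_Idt
        ExtMap_Cmp)
qed

lemma additive_realisation_opposite:
  assumes "additive_realisation K \<C>"
  shows "additive_realisation K (opposite \<C>)"
proof -
  interpret additive_realisation K \<C> by fact
  interpret op: extension_bifunctor K "opposite \<C>"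
    by (rule extension_bifunctor_opposite) unfold_locales
  show ?thesis
  proof (unfold_locales, goal_cases)
    case (1 C A \<delta>)
    then obtain s where s: "s \<in> sequences \<C> C A"
      "Rlz \<C> A C \<delta> = {t \<in> sequences \<C> C A. equivalent_sequences \<C> C A s t}"
      using Rlz_class[of A C \<delta>] by auto
    obtain f B g where fBg: "s = (g, B, f)" by (cases s)
    have "t \<in> Rlz (opposite \<C>) C A \<delta> \<longleftrightarrow>
      t \<in> sequences (opposite \<C>) A C \<and> equivalent_sequences (opposite \<C>) A C (f, B, g) t" for t
    proof -
      obtain f' B' g' where t: "t = (f', B', g')" by (cases t)
      show ?thesis
        unfolding t opposite_simps(7) sequences_opposite equivalent_sequences_opposite s(2) fBg[symmetric]
        using equivalent_sequences_sym[of C A s "(g', B', f')"]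
          equivalent_sequences_sym[of C A "(g', B', f')" s] s(1) 1 by auto
    qed
    then show ?case
      using s(1) by (intro bexI[of _ "(f, B, g)"]) (auto simp: fBg sequences_opposite)
  next
    case (2 A f B g C \<delta> A' f' B' g' C' \<delta>' a c)
    then show ?case
      using realises_morphism[of C' g' B' f' A' \<delta>' C g B f A \<delta> c a] by simp metis
  next
    case (3 A C S i j p q)
    \<comment> \<open>Read backwards, the split sequence starts at the second summand and ends at
      the first, so the summands trade places. The two idempotents are then added in the other
      order.\<close>
    then have "is_biproduct \<C> C A S q p j i"
    proof -
      interpret M: module K "Mor \<C> S S"
        by (rule Mor_module) (use 3 in \<open>auto simp: is_biproduct_def\<close>)
      show ?thesis
        using 3 by (auto simp: is_biproduct_def M.a_comm Cmp_closed)
    qed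
    then show ?case
      using realises_split by simp
  next
    case (4 A f B g C \<delta> A' f' B' g' C' \<delta>' SA iA jA pA qA SB iB jB pB qB SC iC jC pC qC)
    have r: "realises \<C> C g B f A \<delta>" "realises \<C> C' g' B' f' A' \<delta>'"
      using 4 by auto
    note o = realisesD[OF r(1)] realisesD[OF r(2)]
    have b: "is_biproduct \<C> A A' SA pA qA iA jA" "is_biproduct \<C> B B' SB pB qB iB jB"
      "is_biproduct \<C> C C' SC pC qC iC jC"
      using 4 by auto
    from realises_sum[OF r b(3,2,1)] show ?case
      using o b by (simp add: is_biproduct_def Cmp_assoc)
  qed
qed

text \<open>Each axiom becomes its dual. In the octahedral axioms the outer objects \<open>D\<close>
  and \<open>F\<close>, and with them the connecting maps \<open>d\<close> and \<open>e\<close>,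
  exchange roles.\<close>

lemma extriangulated_category_opposite:
  assumes "extriangulated_category K \<C>"
  shows "extriangulated_category K (opposite \<C>)"
proof -
  interpret extriangulated_category K \<C> by fact
  interpret op: additive_realisation K "opposite \<C>"
    by (rule additive_realisation_opposite) unfold_locales
  show ?thesis
  proof (unfold_locales, goal_cases)
    case (1 A f B g C \<delta> A' f' B' g' C' \<delta>' a b)
    then show ?case
      using ET3_op[of C' g' B' f' A' \<delta>' C g B f A \<delta> b a] by simp metis
  next
    case (2 A f B g C \<delta> A' f' B' g' C' \<delta>' b c)
    then show ?case
      using ET3[of C' g' B' f' A' \<delta>' C g B f A \<delta> c b] by simp metis
  next
    case (3 A f B f' D \<delta> g C g' F \<delta>')
    then obtain E d e h h' \<delta>'' where
      "d \<in> Hom \<C> F E" "e \<in> Hom \<C> E D" "realises \<C> E h' C h A \<delta>''" "h = Cmp \<C> C B A f g"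
      "Cmp \<C> F E C h' d = g'" "Cmp \<C> E C B g h' = Cmp \<C> E D B f' e"
      "realises \<C> F d E e D (pull \<C> D B F f' \<delta>')" "push \<C> A E D e \<delta>'' = \<delta>"
      "push \<C> B F E d \<delta>' = pull \<C> B A E f \<delta>''"
      using ET4_op[of F g' C g B \<delta>' D f' f A \<delta>] by auto
    then show ?case
      by (intro exI[of _ E] exI[of _ e] exI[of _ d] exI[of _ h] exI[of _ h'] exI[of _ \<delta>'']) simp
  next
    case (4 D f' A f B \<delta> F g' g C \<delta>')
    then obtain E d e h h' \<delta>'' where
      "d \<in> Hom \<C> F E" "e \<in> Hom \<C> E D" "realises \<C> C h A h' E \<delta>''" "h = Cmp \<C> C B A f g"
      "Cmp \<C> B A E h' f = Cmp \<C> B F E d g'" "Cmp \<C> A E D e h' = f'"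
      "realises \<C> F d E e D (push \<C> D B F g' \<delta>)" "pull \<C> F E C d \<delta>'' = \<delta>'"
      "push \<C> E C B g \<delta>'' = pull \<C> E D B e \<delta>"
      using ET4[of C g B g' F \<delta>' f A f' D \<delta>] by auto
    then show ?case
      by (intro exI[of _ E] exI[of _ e] exI[of _ d] exI[of _ h] exI[of _ h'] exI[of _ \<delta>'']) simp
  qed
qed

section \<open>Long exact sequences\<close>

abbreviation Ext_zero :: "('k, 'o, 'm, 'e) extri \<Rightarrow> 'o \<Rightarrow> 'o \<Rightarrow> bool" where
  "Ext_zero \<C> C A \<equiv> carrier (Ext \<C> C A) = {\<zero>\<^bsub>Ext \<C> C A\<^esub>}"

lemma (in extension_bifunctor) Ext_zeroI:
  assumes "C \<in> Obj \<C>" "A \<in> Obj \<C>" "\<And>\<delta>. \<delta> \<in> carrier (Ext \<C> C A) \<Longrightarrow> \<delta> = \<zero>\<^bsub>Ext \<C> C A\<^esub>"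
  shows "Ext_zero \<C> C A"
proof -
  interpret module K "Ext \<C> C A" by (rule Ext_module[OF assms(1,2)])
  show ?thesis using assms(3) by auto
qed

context extriangulated_category
begin

lemma opposite_extriangulated: "extriangulated_category K (opposite \<C>)"
  by (rule extriangulated_category_opposite) unfold_locales

text \<open>Compare with the trivial conflation 0 -> B -> B: the identity of \<open>B\<close> and
  \<open>g\<close> form a commutative square, so (ET3)^op exhibits the pull-back of \<delta> along
  \<open>g\<close> as a push-out of the zero extension.\<close>

lemma pull_deflation:
  assumes r: "realises \<C> A f B g C \<delta>"
  shows "pull \<C> B C A g \<delta> = \<zero>\<^bsub>Ext \<C> B A\<^esub>"
proof -
  note o = realisesD[OF r]
  obtain Z where Z: "is_zero_object \<C> Z" using ex_zero_object by blast
  then have ZO: "Z \<in> Obj \<C>" by (simp add: is_zero_object_def)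
  have s: "realises \<C> Z \<zero>\<^bsub>Mor \<C> Z B\<^esub> B (Idt \<C> B) B \<zero>\<^bsub>Ext \<C> B Z\<^esub>"
    by (rule realises_split[OF is_biproduct_zero_left[OF Z o(2)]])
  obtain a where a: "extension_morphism \<C> B Z \<zero>\<^bsub>Ext \<C> B Z\<^esub> C A \<delta> a g"
    using ET3_op[OF s r Idt_in_Hom[OF o(2)] o(5) refl] by blast
  then show ?thesis
    using push_zero[OF o(2) ZO o(1), of a] by (simp add: extension_morphism_def)
qed

text \<open>The vanishing condition says that the identity of \<open>A\<close> and \<open>h\<close>
  form a morphism from the split extension of \<open>W\<close> by \<open>A\<close> to \<delta>.
  Realising it gives a map from the biproduct to \<open>B\<close>, and its restriction to the
  summand \<open>W\<close> is the lift.\<close>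

lemma lift_through_deflation:
  assumes r: "realises \<C> A f B g C \<delta>" and W: "W \<in> Obj \<C>" and h: "h \<in> Hom \<C> W C"
    and 0: "pull \<C> W C A h \<delta> = \<zero>\<^bsub>Ext \<C> W A\<^esub>"
  shows "\<exists>k\<in>Hom \<C> W B. Cmp \<C> W B C g k = h"
proof -
  note o = realisesD[OF r]
  obtain S i j p q where b: "is_biproduct \<C> A W S i j p q" using ex_biproduct[OF o(1) W] by blast
  note bD = b[unfolded is_biproduct_def]
  have "extension_morphism \<C> W A \<zero>\<^bsub>Ext \<C> W A\<^esub> C A \<delta> (Idt \<C> A) h"
    using 0 h o by (simp add: extension_morphism_def Idt_in_Hom push_zero W)
  then obtain l where l: "l \<in> Hom \<C> S B" "Cmp \<C> S B C g l = Cmp \<C> S W C h q"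
    using realises_morphism[OF realises_split[OF b] r] by blast
  have "Cmp \<C> W B C g (Cmp \<C> W S B l j) = h"
    using bD o W h l Cmp_assoc[of W S B C j l g] Cmp_assoc[of W S W C j q h]
    by (simp add: Cmp_Idt_right)
  then show ?thesis
    using bD o W l by (intro bexI[of _ "Cmp \<C> W S B l j"]) (auto intro: Cmp_closed)
qed

lemma extend_along_inflation:
  assumes "realises \<C> A f B g C \<delta>" "W \<in> Obj \<C>" "h \<in> Hom \<C> A W"
    and "push \<C> C A W h \<delta> = \<zero>\<^bsub>Ext \<C> C W\<^esub>"
  shows "\<exists>k\<in>Hom \<C> B W. Cmp \<C> A B W k f = h"
  using extriangulated_category.lift_through_deflation[OF opposite_extriangulated, of C g B f A \<delta> W h]
    assms by simp

text \<open>Exactness at \<E>(W, A) of Hom(W, C) -> \<E>(W, A) -> \<E>(W, B). Realise \<epsilon> by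
  A -> E -> W; as its push-out along \<open>f\<close> vanishes, \<open>f\<close> extends to
  \<open>E\<close>, and (ET3) completes this square over the identity of \<open>A\<close> by the map
  from \<open>W\<close> to \<open>C\<close>.\<close>

lemma Ext_exact_left:
  assumes r: "realises \<C> A f B g C \<delta>" and W: "W \<in> Obj \<C>" and e: "\<epsilon> \<in> carrier (Ext \<C> W A)"
    and 0: "push \<C> W A B f \<epsilon> = \<zero>\<^bsub>Ext \<C> W B\<^esub>"
  shows "\<exists>c\<in>Hom \<C> W C. \<epsilon> = pull \<C> W C A c \<delta>"
proof -
  note o = realisesD[OF r]
  obtain x E y where re: "realises \<C> A x E y W \<epsilon>"
    using ex_realisation[OF W o(1) e] by blast
  obtain h where h: "h \<in> Hom \<C> E B" "Cmp \<C> A E B h x = f"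
    using extend_along_inflation[OF re o(2,4) 0] by blast
  have "Cmp \<C> A E B h x = Cmp \<C> A A B f (Idt \<C> A)"
    using h o by (simp add: Cmp_Idt_right)
  then obtain c where "extension_morphism \<C> W A \<epsilon> C A \<delta> (Idt \<C> A) c"
    using ET3[OF re r Idt_in_Hom[OF o(1)] h(1)] by blast
  then show ?thesis
    using push_Idt[OF W o(1) e] by (auto simp: extension_morphism_def)
qed

text \<open>For \<open>\<theta> \<in> \<E>(W, B)\<close> with vanishing push-out along \<open>g\<close>, (ET4) composes \<open>f\<close> with the
  inflation of \<open>\<theta>\<close>; the cone is an extension of \<open>W\<close> by \<open>C\<close> that splits, and pulling back
  along a section yields the preimage.\<close>

lemma Ext_exact_middle:
  assumes r: "realises \<C> A f B g C \<delta>" and W: "W \<in> Obj \<C>" and t: "\<theta> \<in> carrier (Ext \<C> W B)"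
    and 0: "push \<C> W B C g \<theta> = \<zero>\<^bsub>Ext \<C> W C\<^esub>"
  shows "\<exists>\<rho>\<in>carrier (Ext \<C> W A). \<theta> = push \<C> W A B f \<rho>"
proof -
  note o = realisesD[OF r]
  obtain x F y where rt: "realises \<C> B x F y W \<theta>"
    using ex_realisation[OF W o(2) t] by blast
  obtain E d e h h' \<delta>'' where e: "e \<in> Hom \<C> E W" and h: "realises \<C> A h F h' E \<delta>''"
    and re: "realises \<C> C d E e W (push \<C> W B C g \<theta>)"
    and eq: "push \<C> E A B f \<delta>'' = pull \<C> E W B e \<theta>"
    using ET4[OF r rt] by blast
  note oh = realisesD[OF h]
  have "pull \<C> W W C (Idt \<C> W) (push \<C> W B C g \<theta>) = \<zero>\<^bsub>Ext \<C> W C\<^esub>"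
    using 0 o W by (simp add: pull_zero Idt_in_Hom)
  then obtain s where s: "s \<in> Hom \<C> W E" "Cmp \<C> W E W e s = Idt \<C> W"
    using lift_through_deflation[OF re W Idt_in_Hom[OF W]] by blast
  have "push \<C> W A B f (pull \<C> W E A s \<delta>'') = pull \<C> W E B s (push \<C> E A B f \<delta>'')"
    using o oh W s by (simp add: pull_push)
  also have "\<dots> = pull \<C> W W B (Cmp \<C> W E W e s) \<theta>"
    using pull_Cmp[of W E W B s e \<theta>] o oh W s e t by (simp add: eq)
  also have "\<dots> = \<theta>"
    using W o t s by (simp add: pull_Idt)
  finally show ?thesis
    using pull_closed[OF W oh(3,1) s(1) oh(6)] by blast
qed

lemma Ext_coexact_right:
  assumes "realises \<C> A f B g C \<delta>" "W \<in> Obj \<C>" "\<epsilon> \<in> carrier (Ext \<C> C W)"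
    and "pull \<C> B C W g \<epsilon> = \<zero>\<^bsub>Ext \<C> B W\<^esub>"
  shows "\<exists>a\<in>Hom \<C> A W. \<epsilon> = push \<C> C A W a \<delta>"
  using extriangulated_category.Ext_exact_left[OF opposite_extriangulated, of C g B f A \<delta> W \<epsilon>]
    assms by simp

lemma Ext_coexact_middle:
  assumes "realises \<C> A f B g C \<delta>" "W \<in> Obj \<C>" "\<theta> \<in> carrier (Ext \<C> B W)"
    and "pull \<C> A B W f \<theta> = \<zero>\<^bsub>Ext \<C> A W\<^esub>"
  shows "\<exists>\<rho>\<in>carrier (Ext \<C> C W). \<theta> = pull \<C> B C W g \<rho>"
  using extriangulated_category.Ext_exact_middle[OF opposite_extriangulated, of C g B f A \<delta> W \<theta>]
    assms by simp

lemma Ext_zero_middle: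
  assumes r: "realises \<C> A f B g C \<delta>" and W: "W \<in> Obj \<C>"
    and A: "Ext_zero \<C> W A" and C: "Ext_zero \<C> W C"
  shows "Ext_zero \<C> W B"
proof (rule Ext_zeroI)
  note o = realisesD[OF r]
  fix \<theta> assume t: "\<theta> \<in> carrier (Ext \<C> W B)"
  have "push \<C> W B C g \<theta> = \<zero>\<^bsub>Ext \<C> W C\<^esub>"
    using push_closed[OF W o(2,3,5) t] C by simp
  then obtain \<rho> where "\<rho> \<in> carrier (Ext \<C> W A)" "\<theta> = push \<C> W A B f \<rho>"
    using Ext_exact_middle[OF r W t] by blast
  then show "\<theta> = \<zero>\<^bsub>Ext \<C> W B\<^esub>"
    using A push_zero[OF W o(1,2,4)] by simp
qed (use W realisesD[OF r] in auto)

lemma extension_closed_right_perp: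
  assumes "\<X> \<subseteq> Obj \<C>"
  shows "extension_closed \<C> (right_perp \<C> \<X>)"
  unfolding extension_closed_def
proof (intro conjI allI impI)
  show "right_perp \<C> \<X> \<subseteq> Obj \<C>"
    by (auto simp: right_perp_def)
next
  fix A f B g C
  assume *: "conflation \<C> A f B g C \<and> A \<in> right_perp \<C> \<X> \<and> C \<in> right_perp \<C> \<X>"
  then obtain \<delta> where r: "realises \<C> A f B g C \<delta>" by (auto simp: conflation_def)
  show "B \<in> right_perp \<C> \<X>"
    using * realisesD(2)[OF r] Ext_zero_middle[OF r] assms by (auto simp: right_perp_def)
qed

section \<open>Projective and injective objects\<close>

text \<open>The obstruction to lifting \<open>h\<close> through a deflation is a pull-back of its
  extension, an element of \<E>(P, A). Conversely, a lift of the identity of \<open>P\<close> writes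
  \<delta> as a pull-back of its own pull-back along \<open>g\<close>, which is zero. Unlike the
  lifting property, this form can be compared across subcategories and under the duality.\<close>

lemma projective_iff_Ext_zero:
  "projective \<C> P \<longleftrightarrow> P \<in> Obj \<C> \<and> (\<forall>A\<in>Obj \<C>. Ext_zero \<C> P A)"
proof (intro iffI conjI ballI)
  assume P: "projective \<C> P"
  then show PO: "P \<in> Obj \<C>" by (simp add: projective_def)
  fix A assume A: "A \<in> Obj \<C>"
  show "Ext_zero \<C> P A"
  proof (rule Ext_zeroI[OF PO A])
    fix \<delta> assume d: "\<delta> \<in> carrier (Ext \<C> P A)"
    then obtain f B g where r: "realises \<C> A f B g P \<delta>"
      using ex_realisation[OF PO A] by blast
    note o = realisesD[OF r]
    have "deflation \<C> B P g"
      using r by (auto simp: deflation_def conflation_def)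
    then have "Idt \<C> P \<in> (\<lambda>h. Cmp \<C> P B P g h) ` Hom \<C> P B"
      using P Idt_in_Hom[OF PO] by (auto simp: projective_def)
    then obtain s where s: "s \<in> Hom \<C> P B" "Cmp \<C> P B P g s = Idt \<C> P" by (metis imageE)
    have "pull \<C> P P A (Idt \<C> P) \<delta> = pull \<C> P B A s (pull \<C> B P A g \<delta>)"
      using pull_Cmp[OF PO o(2,3) A s(1) o(5) d] by (simp add: s(2))
    then show "\<delta> = \<zero>\<^bsub>Ext \<C> P A\<^esub>"
      using o s(1) d by (simp add: pull_Idt pull_deflation[OF r] pull_zero)
  qed
next
  assume *: "P \<in> Obj \<C> \<and> (\<forall>A\<in>Obj \<C>. Ext_zero \<C> P A)"
  show "projective \<C> P"
    unfolding projective_def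
  proof (intro conjI allI impI equalityI subsetI)
    fix B C g h assume "deflation \<C> B C g" and h: "h \<in> Hom \<C> P C"
    then obtain A f \<delta> where r: "realises \<C> A f B g C \<delta>"
      by (auto simp: deflation_def conflation_def)
    note o = realisesD[OF r]
    have "pull \<C> P C A h \<delta> = \<zero>\<^bsub>Ext \<C> P A\<^esub>"
      using * pull_closed[OF _ o(3,1) h o(6)] o by blast
    then show "h \<in> (\<lambda>h. Cmp \<C> P B C g h) ` Hom \<C> P B"
      using lift_through_deflation[OF r _ h] * by blast
  next
    fix B C g h assume "deflation \<C> B C g" and h: "h \<in> (\<lambda>h. Cmp \<C> P B C g h) ` Hom \<C> P B"
    then obtain A f \<delta> where r: "realises \<C> A f B g C \<delta>"
      by (auto simp: deflation_def conflation_def)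
    show "h \<in> Hom \<C> P C"
      using h * realisesD[OF r] by (auto intro: Cmp_closed)
  qed (use * in blast)
qed

lemma projective_opposite: "projective (opposite \<C>) P \<longleftrightarrow> injective \<C> P"
  by (simp add: projective_def injective_def) blast

lemma injective_opposite: "injective (opposite \<C>) P \<longleftrightarrow> projective \<C> P"
  by (simp add: projective_def injective_def) blast

lemma injective_iff_Ext_zero:
  "injective \<C> I \<longleftrightarrow> I \<in> Obj \<C> \<and> (\<forall>A\<in>Obj \<C>. Ext_zero \<C> A I)"
  using extriangulated_category.projective_iff_Ext_zero[OF opposite_extriangulated]
  by (simp add: projective_opposite)

end

lemma frobenius_opposite:
  assumes "frobenius_extriangulated_category K \<C>"
  shows "frobenius_extriangulated_category K (opposite \<C>)"
proof -
  interpret frobenius_extriangulated_category K \<C> by fact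
  show ?thesis
    by (intro frobenius_extriangulated_category.intro opposite_extriangulated
        frobenius_extriangulated_category_axioms.intro)
      (use enough_projectives enough_injectives projective_iff_injective in
        \<open>simp_all add: projective_opposite injective_opposite\<close>)
qed

section \<open>Approximations by perpendicular subcategories\<close>

lemma right_perp_opposite [simp]: "right_perp (opposite \<C>) \<X> = left_perp \<C> \<X>"
  by (simp add: right_perp_def left_perp_def)

lemma left_perp_opposite [simp]: "left_perp (opposite \<C>) \<X> = right_perp \<C> \<X>"
  by (simp add: right_perp_def left_perp_def)

lemma rigid_opposite [simp]: "rigid (opposite \<C>) \<X> \<longleftrightarrow> rigid \<C> \<X>"
  by (auto simp: rigid_def right_perp_def left_perp_def)

lemma functorially_finite_opposite [simp]:
  "functorially_finite (opposite \<C>) \<X> \<longleftrightarrow> functorially_finite \<C> \<X>"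
proof -
  have "right_approximation (opposite \<C>) \<X> X A r \<longleftrightarrow> left_approximation \<C> \<X> A X r"
    "left_approximation (opposite \<C>) \<X> A X r \<longleftrightarrow> right_approximation \<C> \<X> X A r" for X A r
    by (simp_all add: right_approximation_def left_approximation_def)
  then show ?thesis
    by (auto simp: functorially_finite_def)
qed

context frobenius_extriangulated_category
begin

lemma Ext_zero_projective: "\<lbrakk>projective \<C> P; A \<in> Obj \<C>\<rbrakk> \<Longrightarrow> Ext_zero \<C> P A"
  by (simp add: projective_iff_Ext_zero)

lemma Ext_zero_injective: "\<lbrakk>projective \<C> P; A \<in> Obj \<C>\<rbrakk> \<Longrightarrow> Ext_zero \<C> A P"
  by (simp add: projective_iff_injective injective_iff_Ext_zero)

lemma ex_syzygy:
  assumes "A \<in> Obj \<C>"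
  obtains \<Omega> j P p \<delta> where "projective \<C> P" "realises \<C> \<Omega> j P p A \<delta>"
  using enough_projectives[OF assms] unfolding deflation_def conflation_def by blast

text \<open>Push the syzygy sequence of \<open>A\<close> out along a left approximation of the syzygy.\<close>

lemma left_perp_cover:
  assumes ff: "functorially_finite \<C> \<X>" and rig: "rigid \<C> \<X>" and A: "A \<in> Obj \<C>"
  shows "\<exists>X i Z z \<epsilon>. X \<in> \<X> \<and> Z \<in> left_perp \<C> \<X> \<and> realises \<C> X i Z z A \<epsilon>"
proof -
  have XO: "\<X> \<subseteq> Obj \<C>" using ff by (simp add: functorially_finite_def)
  obtain \<Omega> j P p \<delta> where P: "projective \<C> P" and r: "realises \<C> \<Omega> j P p A \<delta>"
    using ex_syzygy[OF A] .
  note o = realisesD[OF r]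
  obtain X l where l: "left_approximation \<C> \<X> \<Omega> X l"
    using ff o(1) by (auto simp: functorially_finite_def)
  then have X: "X \<in> \<X>" "X \<in> Obj \<C>" "l \<in> Hom \<C> \<Omega> X"
    using XO by (auto simp: left_approximation_def)
  obtain i Z z where re: "realises \<C> X i Z z A (push \<C> A \<Omega> X l \<delta>)"
    using ex_realisation[OF A X(2) push_closed[OF A o(1) X(2,3) o(6)]] by blast
  note oe = realisesD[OF re]
  have "Ext_zero \<C> Z X'" if "X' \<in> \<X>" for X'
  proof (rule Ext_zeroI)
    have X': "X' \<in> Obj \<C>" using that XO by blast
    fix \<theta> assume t: "\<theta> \<in> carrier (Ext \<C> Z X')"
    \<comment> \<open>Rigidity kills the restriction of \<theta> to \<open>X\<close>, so \<theta>
      comes from some \<rho> on \<open>A\<close>. Projectivity of \<open>P\<close> then makes \<rho>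
      a push-out of the syzygy sequence along some \<open>a\<close>.\<close>
    have "Ext_zero \<C> X X'"
      using rig that X by (auto simp: rigid_def right_perp_def)
    then have "pull \<C> X Z X' i \<theta> = \<zero>\<^bsub>Ext \<C> X X'\<^esub>"
      using pull_closed[OF X(2) oe(2) X' oe(4) t] by simp
    then obtain \<rho> where rho: "\<rho> \<in> carrier (Ext \<C> A X')" "\<theta> = pull \<C> Z A X' z \<rho>"
      using Ext_coexact_middle[OF re X' t] by blast
    have "pull \<C> P A X' p \<rho> = \<zero>\<^bsub>Ext \<C> P X'\<^esub>"
      using pull_closed[OF o(2) A X' o(5) rho(1)] Ext_zero_projective[OF P X'] by simp
    then obtain a where a: "a \<in> Hom \<C> \<Omega> X'" "\<rho> = push \<C> A \<Omega> X' a \<delta>"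
      using Ext_coexact_right[OF r X' rho(1)] by blast
    \<comment> \<open>The approximation property enters here: \<open>a\<close> factors through
      \<open>l\<close>, so \<rho> is a push-out of the extension realised by X -> Z -> A. That
      extension becomes zero when pulled back to \<open>Z\<close>, and \<theta> with it.\<close>
    have "\<exists>k\<in>Hom \<C> X X'. a = Cmp \<C> \<Omega> X X' k l"
      using l that a(1) by (simp add: left_approximation_def)
    then obtain k where k: "k \<in> Hom \<C> X X'" "a = Cmp \<C> \<Omega> X X' k l"
      by blast
    have "\<rho> = push \<C> A X X' k (push \<C> A \<Omega> X l \<delta>)"
      using a(2) k X X' o by (simp add: push_Cmp)
    then have "\<theta> = push \<C> Z X X' k (pull \<C> Z A X z (push \<C> A \<Omega> X l \<delta>))"
      using rho(2) oe X' k by (simp add: pull_push)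
    then show "\<theta> = \<zero>\<^bsub>Ext \<C> Z X'\<^esub>"
      using pull_deflation[OF re] oe X' k by (simp add: push_zero)
  qed (use that XO oe in auto)
  then have "Z \<in> left_perp \<C> \<X>" using oe by (simp add: left_perp_def)
  then show ?thesis using X re by blast
qed

lemma right_perp_hull:
  assumes "functorially_finite \<C> \<X>" "rigid \<C> \<X>" "A \<in> Obj \<C>"
  shows "\<exists>X i Z z \<epsilon>. X \<in> \<X> \<and> Z \<in> right_perp \<C> \<X> \<and> realises \<C> A z Z i X \<epsilon>"
proof -
  have "frobenius_extriangulated_category K (opposite \<C>)"
    by (rule frobenius_opposite) unfold_locales
  from frobenius_extriangulated_category.left_perp_cover[OF this, of \<X> A] assms show ?thesis
    by simp
qed

text \<open>With \<open>\<Omega> \<rightarrow> P \<rightarrow> M\<close> a syzygy sequence and \<open>k : \<Omega> \<rightarrow> Z\<close> a hull as above, the push-out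
  \<open>Z \<rightarrow> Q \<rightarrow> M\<close> along \<open>k\<close> is the required sequence.\<close>

lemma right_perp_enough_projectives:
  assumes ff: "functorially_finite \<C> \<X>" and rig: "rigid \<C> \<X>" and M: "M \<in> right_perp \<C> \<X>"
  shows "\<exists>Z w Q q \<epsilon>. Z \<in> right_perp \<C> \<X> \<and> Q \<in> right_perp \<C> \<X> \<and> realises \<C> Z w Q q M \<epsilon> \<and>
    (\<forall>W\<in>right_perp \<C> \<X>. Ext_zero \<C> Q W)"
proof -
  have XO: "\<X> \<subseteq> Obj \<C>" using ff by (simp add: functorially_finite_def)
  have MO: "M \<in> Obj \<C>" using M by (simp add: right_perp_def)
  obtain \<Omega> j P p \<delta> where P: "projective \<C> P" and r: "realises \<C> \<Omega> j P p M \<delta>"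
    using ex_syzygy[OF MO] .
  note o = realisesD[OF r]
  obtain X i Z k \<epsilon> where X: "X \<in> \<X>" and Z: "Z \<in> right_perp \<C> \<X>" and rk: "realises \<C> \<Omega> k Z i X \<epsilon>"
    using right_perp_hull[OF ff rig o(1)] by blast
  note ok = realisesD[OF rk]
  let ?\<eta> = "push \<C> M \<Omega> Z k \<delta>"
  obtain w Q q where rq: "realises \<C> Z w Q q M ?\<eta>"
    using ex_realisation[OF MO ok(2) push_closed[OF MO ok(1,2,4) o(6)]] by blast
  note oq = realisesD[OF rq]
  \<comment> \<open>The comparison of the syzygy sequence with its push-out is wanted for the map
    \<open>u\<close> it induces on middle terms.\<close>
  have "extension_morphism \<C> M \<Omega> \<delta> M Z ?\<eta> k (Idt \<C> M)"
    using oq ok by (simp add: extension_morphism_def Idt_in_Hom pull_Idt)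
  then obtain u where u: "u \<in> Hom \<C> P Q" "Cmp \<C> \<Omega> P Q u j = Cmp \<C> \<Omega> Z Q w k"
    using realises_morphism[OF r rq] by blast
  have "Ext_zero \<C> Q W" if W: "W \<in> right_perp \<C> \<X>" for W
  proof (rule Ext_zeroI)
    have WO: "W \<in> Obj \<C>" and XW: "Ext_zero \<C> X W"
      using W X by (auto simp: right_perp_def)
    have PW: "Ext_zero \<C> P W" by (rule Ext_zero_projective[OF P WO])
    fix \<theta> assume t: "\<theta> \<in> carrier (Ext \<C> Q W)"
    let ?\<tau> = "pull \<C> Z Q W w \<theta>"
    have tau: "?\<tau> \<in> carrier (Ext \<C> Z W)"
      by (rule pull_closed[OF oq(1,2) WO oq(4) t])
    \<comment> \<open>The two routes from \<Omega> to \<open>Q\<close>, through \<open>Z\<close> and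
      through \<open>P\<close>, agree, and the second kills \<theta> because \<E>(P, W) = 0. Hence
      the restriction of \<theta> to \<open>Z\<close> comes from \<E>(X, W) = 0, and \<theta> itself
      comes from \<open>M\<close>.\<close>
    have "pull \<C> \<Omega> Z W k ?\<tau> = pull \<C> \<Omega> Q W (Cmp \<C> \<Omega> Z Q w k) \<theta>"
      using ok oq WO t by (simp add: pull_Cmp)
    also have "\<dots> = pull \<C> \<Omega> P W j (pull \<C> P Q W u \<theta>)"
      unfolding u(2)[symmetric] by (rule pull_Cmp[OF o(1,2) oq(2) WO o(4) u(1) t])
    also have "\<dots> = \<zero>\<^bsub>Ext \<C> \<Omega> W\<^esub>"
      using pull_closed[OF o(2) oq(2) WO u(1) t] PW o WO by (simp add: pull_zero)
    finally obtain \<rho>' where "\<rho>' \<in> carrier (Ext \<C> X W)" "?\<tau> = pull \<C> Z X W i \<rho>'"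
      using Ext_coexact_middle[OF rk WO tau] by blast
    then have "?\<tau> = \<zero>\<^bsub>Ext \<C> Z W\<^esub>"
      using XW ok WO by (simp add: pull_zero)
    then obtain \<rho> where rho: "\<rho> \<in> carrier (Ext \<C> M W)" "\<theta> = pull \<C> Q M W q \<rho>"
      using Ext_coexact_middle[OF rq WO t] by blast
    have "pull \<C> P M W p \<rho> = \<zero>\<^bsub>Ext \<C> P W\<^esub>"
      using pull_closed[OF o(2) MO WO o(5) rho(1)] PW by simp
    then obtain b where b: "b \<in> Hom \<C> \<Omega> W" "\<rho> = push \<C> M \<Omega> W b \<delta>"
      using Ext_coexact_right[OF r WO rho(1)] by blast
    \<comment> \<open>The other use of \<E>(X, W) = 0: maps from \<Omega> to objects of the
      perpendicular category extend along \<open>k\<close>. So \<rho> is a push-out of the extension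
      defining \<open>Q\<close> and dies on \<open>Q\<close>.\<close>
    have "push \<C> X \<Omega> W b \<epsilon> = \<zero>\<^bsub>Ext \<C> X W\<^esub>"
      using push_closed[OF ok(3,1) WO b(1) ok(6)] XW by simp
    then obtain a where a: "a \<in> Hom \<C> Z W" "Cmp \<C> \<Omega> Z W a k = b"
      using extend_along_inflation[OF rk WO b(1)] by blast
    have "\<rho> = push \<C> M Z W a ?\<eta>"
      using a b(2) o ok WO push_Cmp[of M \<Omega> Z W k a \<delta>] by simp
    then have "\<theta> = push \<C> Q Z W a (pull \<C> Q M Z q ?\<eta>)"
      using rho(2) oq WO a by (simp add: pull_push)
    then show "\<theta> = \<zero>\<^bsub>Ext \<C> Q W\<^esub>"
      using pull_deflation[OF rq] oq WO a by (simp add: push_zero)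
  qed (use W oq in \<open>auto simp: right_perp_def\<close>)
  moreover have "Q \<in> right_perp \<C> \<X>"
  proof -
    have "conflation \<C> Z w Q q M"
      using rq unfolding conflation_def by (rule exI)
    then show ?thesis
      using extension_closed_right_perp[OF XO] Z M unfolding extension_closed_def by blast
  qed
  ultimately show ?thesis using Z rq by blast
qed

lemma left_perp_enough_injectives:
  assumes "functorially_finite \<C> \<X>" "rigid \<C> \<X>" "M \<in> left_perp \<C> \<X>"
  shows "\<exists>Z w Q q \<epsilon>. Z \<in> left_perp \<C> \<X> \<and> Q \<in> left_perp \<C> \<X> \<and> realises \<C> M q Q w Z \<epsilon> \<and>
    (\<forall>W\<in>left_perp \<C> \<X>. Ext_zero \<C> W Q)"
proof -
  have "frobenius_extriangulated_category K (opposite \<C>)"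
    by (rule frobenius_opposite) unfold_locales
  from frobenius_extriangulated_category.right_perp_enough_projectives[OF this, of \<X> M] assms
  show ?thesis by simp
qed

end

section \<open>The stable category and the two-Calabi--Yau property\<close>

text \<open>Only the morphism sets and their two-sided action on the modules \<open>M\<close> are
  recorded, so that the same predicate applies to stable morphisms into a suspension and to
  \<E>.\<close>

definition natural_duality ::
  "'k ring \<Rightarrow> 'o set \<Rightarrow> ('o \<Rightarrow> 'o \<Rightarrow> 'h set) \<Rightarrow> ('o \<Rightarrow> 'o \<Rightarrow> ('k, 'e) module) \<Rightarrow>
   ('o \<Rightarrow> 'o \<Rightarrow> 'o \<Rightarrow> 'o \<Rightarrow> 'h \<Rightarrow> 'h \<Rightarrow> 'e \<Rightarrow> 'e) \<Rightarrow> bool" where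
  "natural_duality K Ob H M act \<longleftrightarrow>
     (\<exists>\<eta>.
       (\<forall>X\<in>Ob. \<forall>Y\<in>Ob. linear_iso K (M X Y) (dual_module K (M Y X)) (\<eta> X Y)) \<and>
       (\<forall>X\<in>Ob. \<forall>Y\<in>Ob. \<forall>X'\<in>Ob. \<forall>Y'\<in>Ob. \<forall>x\<in>H X' X. \<forall>y\<in>H Y Y'.
          \<forall>e\<in>carrier (M X Y). \<forall>e'\<in>carrier (M Y' X').
            \<eta> X' Y' (act X Y X' Y' x y e) e' = \<eta> X Y e (act Y' X' Y X y x e')))"

lemma two_calabi_yau_iff_natural_duality:
  "two_calabi_yau K \<T> S Sm \<longleftrightarrow>
     (\<forall>X\<in>Obj \<T>. \<forall>Y\<in>Obj \<T>. finite_dimensional K (Mor \<T> X Y)) \<and>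
     natural_duality K (Obj \<T>) (Hom \<T>) (\<lambda>X Y. Mor \<T> X (S Y)) (ext1_map \<T> S Sm)"
  unfolding two_calabi_yau_def natural_duality_def ..

text \<open>The new pairing evaluates the old one on the images under \<Psi>. The translation
  \<open>t\<close> of morphisms only has to be compatible with the actions; functoriality is not
  demanded, which permits an arbitrary choice of representatives.\<close>

lemma natural_duality_transport:
  assumes dual: "natural_duality K Ob H M act"
    and M: "\<And>X Y. \<lbrakk>X \<in> Ob; Y \<in> Ob\<rbrakk> \<Longrightarrow> module K (M X Y)"
    and N: "\<And>X Y. \<lbrakk>X \<in> Ob; Y \<in> Ob\<rbrakk> \<Longrightarrow> module K (N X Y)"
    and iso: "\<And>X Y. \<lbrakk>X \<in> Ob; Y \<in> Ob\<rbrakk> \<Longrightarrow> linear_iso K (N X Y) (M X Y) (\<Psi> X Y)"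
    and t: "\<And>X X' x. \<lbrakk>X \<in> Ob; X' \<in> Ob; x \<in> H' X' X\<rbrakk> \<Longrightarrow> t X' X x \<in> H X' X"
    and act_closed: "\<And>X Y X' Y' x y e. \<lbrakk>X \<in> Ob; Y \<in> Ob; X' \<in> Ob; Y' \<in> Ob;
        x \<in> H' X' X; y \<in> H' Y Y'; e \<in> carrier (N X Y)\<rbrakk>
      \<Longrightarrow> act' X Y X' Y' x y e \<in> carrier (N X' Y')"
    and act: "\<And>X Y X' Y' x y e. \<lbrakk>X \<in> Ob; Y \<in> Ob; X' \<in> Ob; Y' \<in> Ob;
        x \<in> H' X' X; y \<in> H' Y Y'; e \<in> carrier (N X Y)\<rbrakk>
      \<Longrightarrow> \<Psi> X' Y' (act' X Y X' Y' x y e) = act X Y X' Y' (t X' X x) (t Y Y' y) (\<Psi> X Y e)"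
  shows "natural_duality K Ob H' N act'"
proof -
  obtain \<eta> where \<eta>: "\<forall>X\<in>Ob. \<forall>Y\<in>Ob. linear_iso K (M X Y) (dual_module K (M Y X)) (\<eta> X Y)"
    and nat: "\<forall>X\<in>Ob. \<forall>Y\<in>Ob. \<forall>X'\<in>Ob. \<forall>Y'\<in>Ob. \<forall>x\<in>H X' X. \<forall>y\<in>H Y Y'.
      \<forall>e\<in>carrier (M X Y). \<forall>e'\<in>carrier (M Y' X').
        \<eta> X' Y' (act X Y X' Y' x y e) e' = \<eta> X Y e (act Y' X' Y X y x e')"
    using dual unfolding natural_duality_def by blast
  have cl: "\<Psi> X Y e \<in> carrier (M X Y)" if "X \<in> Ob" "Y \<in> Ob" "e \<in> carrier (N X Y)" for X Y e
    by (rule linear_map_closed[OF linear_iso_linear[OF iso] that(3)]) fact+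
  show ?thesis
    unfolding natural_duality_def
  proof (intro exI[of _ "\<lambda>X Y e. \<lambda>e'\<in>carrier (N Y X). \<eta> X Y (\<Psi> X Y e) (\<Psi> Y X e')"] conjI ballI)
    fix X Y assume XY: "X \<in> Ob" "Y \<in> Ob"
    show "linear_iso K (N X Y) (dual_module K (N Y X))
        (\<lambda>e. \<lambda>e'\<in>carrier (N Y X). \<eta> X Y (\<Psi> X Y e) (\<Psi> Y X e'))"
      by (rule linear_iso_comp[OF linear_iso_comp[OF iso[OF XY] \<eta>[rule_format, OF XY]]
            linear_iso_dual[OF N[OF XY(2,1)] M[OF XY(2,1)] iso[OF XY(2,1)]]])
  next
    fix X Y X' Y' x y e e'
    assume *: "X \<in> Ob" "Y \<in> Ob" "X' \<in> Ob" "Y' \<in> Ob" "x \<in> H' X' X" "y \<in> H' Y Y'"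
      "e \<in> carrier (N X Y)" "e' \<in> carrier (N Y' X')"
    show "(\<lambda>e'\<in>carrier (N Y' X'). \<eta> X' Y' (\<Psi> X' Y' (act' X Y X' Y' x y e)) (\<Psi> Y' X' e')) e' =
      (\<lambda>e'\<in>carrier (N Y X). \<eta> X Y (\<Psi> X Y e) (\<Psi> Y X e')) (act' Y' X' Y X y x e')"
      using * by (simp add: act act_closed nat cl t)
  qed
qed

lemma stable_category_simps [simp]:
  "Obj (stable_category \<C>) = Obj \<C>"
  "Mor (stable_category \<C>) A B = quotient_module (Mor \<C> A B) (stable_ideal \<C> A B)"
  "Cmp (stable_category \<C>) A B C G F =
    (\<Union>g\<in>G. \<Union>f\<in>F. stable_ideal \<C> A C +>\<^bsub>Mor \<C> A C\<^esub> Cmp \<C> A B C g f)"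
  by (simp_all add: stable_category_def)

context frobenius_extriangulated_category
begin

text \<open>A map factors through some projective exactly when it factors through the deflation
  \<open>p\<close>, and \<delta> measures the obstruction. This presents the ideal as the kernel of
  a linear map. It applies equally to a suspension conflation, whose middle term is injective and
  hence projective.\<close>

lemma mem_stable_ideal_iff:
  assumes r: "realises \<C> \<Omega> j P p B \<delta>" and P: "projective \<C> P" and A: "A \<in> Obj \<C>"
  shows "f \<in> stable_ideal \<C> A B \<longleftrightarrow> f \<in> Hom \<C> A B \<and> pull \<C> A B \<Omega> f \<delta> = \<zero>\<^bsub>Ext \<C> A \<Omega>\<^esub>"
proof (intro iffI)
  note o = realisesD[OF r]
  assume "f \<in> stable_ideal \<C> A B"
  then obtain Q u v where Q: "projective \<C> Q" "u \<in> Hom \<C> A Q" "v \<in> Hom \<C> Q B"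
    and f: "f = Cmp \<C> A Q B v u"
    by (auto simp: stable_ideal_def)
  have QO: "Q \<in> Obj \<C>" using Q(1) by (simp add: projective_def)
  have "pull \<C> Q B \<Omega> v \<delta> = \<zero>\<^bsub>Ext \<C> Q \<Omega>\<^esub>"
    using pull_closed[OF QO o(3,1) Q(3) o(6)] Ext_zero_projective[OF Q(1) o(1)] by simp
  then show "f \<in> Hom \<C> A B \<and> pull \<C> A B \<Omega> f \<delta> = \<zero>\<^bsub>Ext \<C> A \<Omega>\<^esub>"
    using o A Q QO by (simp add: f pull_Cmp pull_zero Cmp_closed)
next
  note o = realisesD[OF r]
  assume "f \<in> Hom \<C> A B \<and> pull \<C> A B \<Omega> f \<delta> = \<zero>\<^bsub>Ext \<C> A \<Omega>\<^esub>"
  then obtain k where "k \<in> Hom \<C> A P" "Cmp \<C> A P B p k = f"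
    using lift_through_deflation[OF r A] by blast
  then show "f \<in> stable_ideal \<C> A B"
    using P projective_iff_injective o(5) unfolding stable_ideal_def by blast
qed

lemma submodule_stable_ideal:
  assumes "A \<in> Obj \<C>" "B \<in> Obj \<C>"
  shows "submodule (stable_ideal \<C> A B) K (Mor \<C> A B)"
proof -
  obtain \<Omega> j P p \<delta> where P: "projective \<C> P" and r: "realises \<C> \<Omega> j P p B \<delta>"
    using ex_syzygy[OF assms(2)] .
  note o = realisesD[OF r]
  have "stable_ideal \<C> A B = {f \<in> Hom \<C> A B. pull \<C> A B \<Omega> f \<delta> = \<zero>\<^bsub>Ext \<C> A \<Omega>\<^esub>}"
    using mem_stable_ideal_iff[OF r P assms(1)] by blast
  then show ?thesis
    using submodule_kernel[OF Mor_module[OF assms] Ext_module[OF assms(1) o(1)]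
        pull_linear_mor[OF assms o(1,6)]] by simp
qed

lemma stable_quotient: "\<lbrakk>A \<in> Obj \<C>; B \<in> Obj \<C>\<rbrakk> \<Longrightarrow> module_quotient K (Mor \<C> A B) (stable_ideal \<C> A B)"
  by (intro module_quotient.intro module_quotient_axioms.intro Mor_module submodule_stable_ideal)

lemma stable_module:
  "\<lbrakk>A \<in> Obj \<C>; B \<in> Obj \<C>\<rbrakk> \<Longrightarrow> module K (Mor (stable_category \<C>) A B)"
  by (simp add: module_quotient.quotient_is_module[OF stable_quotient])

lemma stable_class_in_Hom:
  "\<lbrakk>A \<in> Obj \<C>; B \<in> Obj \<C>; f \<in> Hom \<C> A B\<rbrakk>
   \<Longrightarrow> stable_ideal \<C> A B +>\<^bsub>Mor \<C> A B\<^esub> f \<in> Hom (stable_category \<C>) A B"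
  by (simp add: module_quotient.quotient_carrier[OF stable_quotient])

lemma mem_stable_class:
  "\<lbrakk>A \<in> Obj \<C>; B \<in> Obj \<C>; f \<in> Hom \<C> A B\<rbrakk> \<Longrightarrow> f \<in> stable_ideal \<C> A B +>\<^bsub>Mor \<C> A B\<^esub> f"
  by (simp add: module_quotient.mem_cls_iff[OF stable_quotient])

lemma stable_morphismD:
  assumes AB: "A \<in> Obj \<C>" "B \<in> Obj \<C>" and \<phi>: "\<phi> \<in> Hom (stable_category \<C>) A B"
  shows "\<phi> \<noteq> {}" and "\<And>f. f \<in> \<phi> \<Longrightarrow> f \<in> Hom \<C> A B \<and> \<phi> = stable_ideal \<C> A B +>\<^bsub>Mor \<C> A B\<^esub> f"
proof -
  obtain x where x: "x \<in> Hom \<C> A B" "\<phi> = stable_ideal \<C> A B +>\<^bsub>Mor \<C> A B\<^esub> x"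
    using \<phi> module_quotient.quotient_carrier[OF stable_quotient[OF AB]] by auto
  show "\<phi> \<noteq> {}"
    using mem_stable_class[OF AB x(1)] x(2) by blast
  show "f \<in> Hom \<C> A B \<and> \<phi> = stable_ideal \<C> A B +>\<^bsub>Mor \<C> A B\<^esub> f" if "f \<in> \<phi>" for f
    using that x module_quotient.mem_cls_iff[OF stable_quotient[OF AB] x(1), of f] by simp
qed

lemma linear_map_stable_class:
  assumes AB: "A \<in> Obj \<C>" "B \<in> Obj \<C>" and N: "module K N" and h: "linear_map K (Mor \<C> A B) N h"
    and 0: "\<And>f. f \<in> stable_ideal \<C> A B \<Longrightarrow> h f = \<zero>\<^bsub>N\<^esub>"
    and \<phi>: "\<phi> \<in> Hom (stable_category \<C>) A B" "f \<in> \<phi>" "f' \<in> \<phi>"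
  shows "h f = h f'"
  using module_quotient.quotient_universal(2)[OF stable_quotient[OF AB] N h 0]
    stable_morphismD(2)[OF AB \<phi>(1,2)] stable_morphismD(2)[OF AB \<phi>(1,3)] by metis

text \<open>Representatives differ by a map through a projective \<open>P\<close>, whose action
  factors through \<E>(P, W) = 0. With its push-out counterpart, this lets \<E> be evaluated on
  stable classes.\<close>

lemma pull_stable_class:
  assumes AB: "A \<in> Obj \<C>" "B \<in> Obj \<C>" and W: "W \<in> Obj \<C>" "\<theta> \<in> carrier (Ext \<C> B W)"
    and \<phi>: "\<phi> \<in> Hom (stable_category \<C>) A B" "f \<in> \<phi>" "f' \<in> \<phi>"
  shows "pull \<C> A B W f \<theta> = pull \<C> A B W f' \<theta>"
proof (rule linear_map_stable_class[OF AB Ext_module[OF AB(1) W(1)] pull_linear_mor[OF AB W] _ \<phi>])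
  fix f assume "f \<in> stable_ideal \<C> A B"
  then obtain P u v where P: "projective \<C> P" "u \<in> Hom \<C> A P" "v \<in> Hom \<C> P B"
    and f: "f = Cmp \<C> A P B v u"
    by (auto simp: stable_ideal_def)
  have PO: "P \<in> Obj \<C>" using P(1) by (simp add: projective_def)
  show "pull \<C> A B W f \<theta> = \<zero>\<^bsub>Ext \<C> A W\<^esub>"
    using pull_closed[OF PO AB(2) W(1) P(3) W(2)] Ext_zero_projective[OF P(1) W(1)] AB W P PO
    by (simp add: f pull_Cmp pull_zero)
qed

lemma push_stable_class:
  assumes AB: "A \<in> Obj \<C>" "B \<in> Obj \<C>" and W: "W \<in> Obj \<C>" "\<theta> \<in> carrier (Ext \<C> W A)"
    and \<phi>: "\<phi> \<in> Hom (stable_category \<C>) A B" "f \<in> \<phi>" "f' \<in> \<phi>"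
  shows "push \<C> W A B f \<theta> = push \<C> W A B f' \<theta>"
proof (rule linear_map_stable_class[OF AB Ext_module[OF W(1) AB(2)] _ _ \<phi>])
  show "linear_map K (Mor \<C> A B) (Ext \<C> W B) (\<lambda>f. push \<C> W A B f \<theta>)"
    unfolding push_def by (rule ExtMap_linear_right) (use AB W Idt_in_Hom in auto)
  fix f assume "f \<in> stable_ideal \<C> A B"
  then obtain P u v where P: "projective \<C> P" "u \<in> Hom \<C> A P" "v \<in> Hom \<C> P B"
    and f: "f = Cmp \<C> A P B v u"
    by (auto simp: stable_ideal_def)
  have PO: "P \<in> Obj \<C>" using P(1) by (simp add: projective_def)
  show "push \<C> W A B f \<theta> = \<zero>\<^bsub>Ext \<C> W B\<^esub>"
    using push_closed[OF W(1) AB(1) PO P(2) W(2)] Ext_zero_injective[OF P(1) W(1)] AB W P PO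
    by (simp add: f push_Cmp push_zero)
qed

end

section \<open>Stable morphisms into a suspension viewed as extensions\<close>

locale suspended_frobenius = frobenius_extriangulated_category K \<C>
  for K :: "'k ring" and \<C> :: "('k, 'o, 'm, 'e) extri" +
  fixes S :: "'o \<Rightarrow> 'o" and \<sigma> :: "'o \<Rightarrow> 'e"
  assumes susp: "suspension \<C> S \<sigma>"
begin

lemma ex_suspension:
  assumes "X \<in> Obj \<C>"
  obtains i I p where "projective \<C> I" "realises \<C> X i I p (S X) (\<sigma> X)"
  using susp assms unfolding suspension_def projective_iff_injective by blast

lemma S_Obj [simp]: "X \<in> Obj \<C> \<Longrightarrow> S X \<in> Obj \<C>"
  and \<sigma>_Ext [simp]: "X \<in> Obj \<C> \<Longrightarrow> \<sigma> X \<in> carrier (Ext \<C> (S X) X)"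
  by (meson ex_suspension realisesD)+

text \<open>The connecting map of Y -> I -> S Y, descended to stable classes. The image of a class
  is a singleton by \<open>pull_stable_class\<close>.\<close>

definition ext_of :: "'o \<Rightarrow> 'o \<Rightarrow> 'm set \<Rightarrow> 'e" where
  "ext_of X Y \<phi> = the_elem ((\<lambda>f. pull \<C> X (S Y) Y f (\<sigma> Y)) ` \<phi>)"

lemma ex_pull_\<sigma>:
  assumes X: "X \<in> Obj \<C>" and Y: "Y \<in> Obj \<C>" and e: "e \<in> carrier (Ext \<C> X Y)"
  shows "\<exists>f\<in>Hom \<C> X (S Y). e = pull \<C> X (S Y) Y f (\<sigma> Y)"
proof -
  obtain i I p where I: "projective \<C> I" and r: "realises \<C> Y i I p (S Y) (\<sigma> Y)"
    using ex_suspension[OF Y] .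
  note o = realisesD[OF r]
  have "push \<C> X Y I i e = \<zero>\<^bsub>Ext \<C> X I\<^esub>"
    using push_closed[OF X Y o(2,4) e] Ext_zero_injective[OF I X] by simp
  then show ?thesis
    using Ext_exact_left[OF r X e] by blast
qed

text \<open>Surjectivity comes from injectivity of \<open>I\<close>, as \<E>(X, I) = 0. The kernel
  is the stable ideal because \<open>I\<close> is projective as well, so
  \<open>mem_stable_ideal_iff\<close> applies with \<open>\<sigma> Y\<close> as the
  extension.\<close>

lemma linear_iso_ext_of:
  assumes X: "X \<in> Obj \<C>" and Y: "Y \<in> Obj \<C>"
  shows "linear_iso K (Mor (stable_category \<C>) X (S Y)) (Ext \<C> X Y) (ext_of X Y)"
proof -
  obtain i I p where I: "projective \<C> I" and r: "realises \<C> Y i I p (S Y) (\<sigma> Y)"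
    using ex_suspension[OF Y] .
  have lin: "linear_map K (Mor \<C> X (S Y)) (Ext \<C> X Y) (\<lambda>f. pull \<C> X (S Y) Y f (\<sigma> Y))"
    using X Y by (simp add: pull_linear_mor)
  have "(\<lambda>f. pull \<C> X (S Y) Y f (\<sigma> Y)) ` Hom \<C> X (S Y) = carrier (Ext \<C> X Y)"
    using ex_pull_\<sigma>[OF X Y] linear_map_closed[OF lin] by auto
  from module_quotient.first_isomorphism[OF stable_quotient Ext_module lin mem_stable_ideal_iff[OF r I] this]
  show ?thesis
    using X Y unfolding ext_of_def[abs_def] by simp
qed

lemma ext_of_eq:
  assumes XY: "X \<in> Obj \<C>" "Y \<in> Obj \<C>" and \<phi>: "\<phi> \<in> Hom (stable_category \<C>) X (S Y)" "f \<in> \<phi>"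
  shows "ext_of X Y \<phi> = pull \<C> X (S Y) Y f (\<sigma> Y)"
proof -
  have "pull \<C> X (S Y) Y f' (\<sigma> Y) = pull \<C> X (S Y) Y f (\<sigma> Y)" if "f' \<in> \<phi>" for f'
    by (rule pull_stable_class[OF XY(1) S_Obj[OF XY(2)] XY(2) \<sigma>_Ext[OF XY(2)] \<phi>(1) that \<phi>(2)])
  then have "(\<lambda>f. pull \<C> X (S Y) Y f (\<sigma> Y)) ` \<phi> = {pull \<C> X (S Y) Y f (\<sigma> Y)}"
    using \<phi>(2) by blast
  then show ?thesis by (simp add: ext_of_def)
qed

lemma stable_class_eqI:
  assumes XY: "X \<in> Obj \<C>" "Y \<in> Obj \<C>" and \<phi>: "\<phi> \<in> Hom (stable_category \<C>) X (S Y)"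
    and f: "f \<in> Hom \<C> X (S Y)" "pull \<C> X (S Y) Y f (\<sigma> Y) = ext_of X Y \<phi>"
  shows "stable_ideal \<C> X (S Y) +>\<^bsub>Mor \<C> X (S Y)\<^esub> f = \<phi>"
proof (rule inj_onD)
  show "inj_on (ext_of X Y) (Hom (stable_category \<C>) X (S Y))"
    using linear_iso_ext_of[OF XY] by (simp add: linear_iso_def bij_betw_def)
  have c: "stable_ideal \<C> X (S Y) +>\<^bsub>Mor \<C> X (S Y)\<^esub> f \<in> Hom (stable_category \<C>) X (S Y)"
    using XY f by (intro stable_class_in_Hom) auto
  then show "stable_ideal \<C> X (S Y) +>\<^bsub>Mor \<C> X (S Y)\<^esub> f \<in> Hom (stable_category \<C>) X (S Y)" .
  show "ext_of X Y (stable_ideal \<C> X (S Y) +>\<^bsub>Mor \<C> X (S Y)\<^esub> f) = ext_of X Y \<phi>"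
    using ext_of_eq[OF XY c mem_stable_class] XY f by simp
qed fact

text \<open>A stable composite is a union of classes over all pairs of representatives. If each pair
  yields the same extension \<open>e\<close>, injectivity of \<open>ext_of\<close> makes all these
  classes equal. \<open>G\<close> and \<open>F\<close> are merely nonempty sets of morphisms, so the
  lemma can be applied to \<open>suspension_map\<close> without knowing beforehand that it is a
  coset.\<close>

lemma stable_Cmp_eqI:
  assumes XYZ: "X \<in> Obj \<C>" "Y \<in> Obj \<C>" "Z \<in> Obj \<C>" and e: "e \<in> carrier (Ext \<C> X Z)"
    and ne: "G \<noteq> {}" "F \<noteq> {}" and F: "F \<subseteq> Hom \<C> X Y" and G: "G \<subseteq> Hom \<C> Y (S Z)"
    and eq: "\<And>g f. \<lbrakk>g \<in> G; f \<in> F\<rbrakk> \<Longrightarrow> pull \<C> X Y Z f (pull \<C> Y (S Z) Z g (\<sigma> Z)) = e"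
  shows "Cmp (stable_category \<C>) X Y (S Z) G F \<in> Hom (stable_category \<C>) X (S Z)"
    and "ext_of X Z (Cmp (stable_category \<C>) X Y (S Z) G F) = e"
proof -
  have "e \<in> ext_of X Z ` Hom (stable_category \<C>) X (S Z)"
    using linear_iso_ext_of[OF XYZ(1,3)] e by (simp add: linear_iso_def bij_betw_def)
  then obtain \<phi> where \<phi>: "\<phi> \<in> Hom (stable_category \<C>) X (S Z)" "e = ext_of X Z \<phi>" by blast
  have "stable_ideal \<C> X (S Z) +>\<^bsub>Mor \<C> X (S Z)\<^esub> Cmp \<C> X Y (S Z) g f = \<phi>"
    if "g \<in> G" "f \<in> F" for g f
  proof (rule stable_class_eqI[OF XYZ(1,3) \<phi>(1)])
    have gf: "g \<in> Hom \<C> Y (S Z)" "f \<in> Hom \<C> X Y" using that F G by blast+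
    show "Cmp \<C> X Y (S Z) g f \<in> Hom \<C> X (S Z)"
      using XYZ gf by (intro Cmp_closed) auto
    show "pull \<C> X (S Z) Z (Cmp \<C> X Y (S Z) g f) (\<sigma> Z) = ext_of X Z \<phi>"
      using eq[OF that] XYZ gf pull_Cmp[of X Y "S Z" Z f g "\<sigma> Z"] \<phi>(2) by simp
  qed
  then have "(\<Union>g\<in>G. \<Union>f\<in>F. stable_ideal \<C> X (S Z) +>\<^bsub>Mor \<C> X (S Z)\<^esub> Cmp \<C> X Y (S Z) g f) =
      (\<Union>g\<in>G. \<Union>f\<in>F. \<phi>)"
    by (intro SUP_cong refl)
  also have "\<dots> = \<phi>" using ne by blast
  finally have "Cmp (stable_category \<C>) X Y (S Z) G F = \<phi>" by simp
  then show "Cmp (stable_category \<C>) X Y (S Z) G F \<in> Hom (stable_category \<C>) X (S Z)"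
    "ext_of X Z (Cmp (stable_category \<C>) X Y (S Z) G F) = e"
    using \<phi> by auto
qed

text \<open>A member \<open>c\<close> of the suspension of \<open>y\<close> satisfies that the
  pull-back of \<open>\<sigma> Y'\<close> along \<open>c\<close> is a push-out of
  \<open>\<sigma> Y\<close> along a representative of \<open>y\<close>. Thus composing with
  \<open>c\<close> becomes pushing out along \<open>y\<close>, and composing with \<open>x\<close>
  becomes pulling back; the two composites are evaluated in turn by
  \<open>stable_Cmp_eqI\<close>.\<close>

lemma ext_of_ext1_map:
  assumes O: "X \<in> Obj \<C>" "Y \<in> Obj \<C>" "X' \<in> Obj \<C>" "Y' \<in> Obj \<C>"
    and x: "x \<in> Hom (stable_category \<C>) X' X" "x\<^sub>0 \<in> x"
    and y: "y \<in> Hom (stable_category \<C>) Y Y'" "y\<^sub>0 \<in> y"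
    and \<epsilon>: "\<epsilon> \<in> Hom (stable_category \<C>) X (S Y)"
  defines "\<epsilon>' \<equiv> ext1_map (stable_category \<C>) S (suspension_map \<C> S \<sigma>) X Y X' Y' x y \<epsilon>"
  shows "\<epsilon>' \<in> Hom (stable_category \<C>) X' (S Y')"
    and "ext_of X' Y' \<epsilon>' = ExtMap \<C> X Y X' Y' x\<^sub>0 y\<^sub>0 (ext_of X Y \<epsilon>)"
proof -
  let ?Sy = "suspension_map \<C> S \<sigma> Y Y' y"
  define m where "m = Cmp (stable_category \<C>) X (S Y) (S Y') ?Sy \<epsilon>"
  let ?e = "push \<C> X Y Y' y\<^sub>0 (ext_of X Y \<epsilon>)"
  have x0: "x\<^sub>0 \<in> Hom \<C> X' X" and y0: "y\<^sub>0 \<in> Hom \<C> Y Y'"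
    using stable_morphismD(2)[OF O(3,1) x] stable_morphismD(2)[OF O(2,4) y] by auto
  have eps: "ext_of X Y \<epsilon> \<in> carrier (Ext \<C> X Y)"
    by (rule linear_map_closed[OF linear_iso_linear[OF linear_iso_ext_of[OF O(1,2)]] \<epsilon>])
  have e: "?e \<in> carrier (Ext \<C> X Y')"
    by (rule push_closed[OF O(1,2,4) y0 eps])
  \<comment> \<open>A suspension of \<open>y\<close> exists: this push-out lies in \<E>(S Y, Y'),
    where every extension is a pull-back of \<open>\<sigma> Y'\<close>.\<close>
  have "push \<C> (S Y) Y Y' y\<^sub>0 (\<sigma> Y) \<in> carrier (Ext \<C> (S Y) Y')"
    using O y0 by (intro push_closed) auto
  then obtain c where "c \<in> Hom \<C> (S Y) (S Y')"
    "push \<C> (S Y) Y Y' y\<^sub>0 (\<sigma> Y) = pull \<C> (S Y) (S Y') Y' c (\<sigma> Y')"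
    using ex_pull_\<sigma>[of "S Y" Y'] O by auto
  then have "c \<in> ?Sy"
    using y(2) y0 by (auto simp: suspension_map_def extension_morphism_def)
  then have ne: "?Sy \<noteq> {}" by blast
  have Sy: "?Sy \<subseteq> Hom \<C> (S Y) (S Y')"
    by (auto simp: suspension_map_def extension_morphism_def)
  have E: "\<epsilon> \<subseteq> Hom \<C> X (S Y)" "\<epsilon> \<noteq> {}"
    using stable_morphismD[OF O(1) S_Obj[OF O(2)] \<epsilon>] by auto
  have c: "pull \<C> X (S Y) Y' f (pull \<C> (S Y) (S Y') Y' c (\<sigma> Y')) = ?e" if "c \<in> ?Sy" "f \<in> \<epsilon>" for c f
  proof -
    have f: "f \<in> Hom \<C> X (S Y)" using that E by blast
    obtain y1 where y1: "y1 \<in> y" "push \<C> (S Y) Y Y' y1 (\<sigma> Y) = pull \<C> (S Y) (S Y') Y' c (\<sigma> Y')"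
      using \<open>c \<in> ?Sy\<close> by (auto simp: suspension_map_def extension_morphism_def)
    have y1H: "y1 \<in> Hom \<C> Y Y'"
      using stable_morphismD(2)[OF O(2,4) y(1) y1(1)] by simp
    have "pull \<C> X (S Y) Y' f (push \<C> (S Y) Y Y' y1 (\<sigma> Y)) = push \<C> X Y Y' y1 (pull \<C> X (S Y) Y f (\<sigma> Y))"
      using O f y1H by (intro pull_push) auto
    also have "\<dots> = push \<C> X Y Y' y1 (ext_of X Y \<epsilon>)"
      using ext_of_eq[OF O(1,2) \<epsilon> \<open>f \<in> \<epsilon>\<close>] by simp
    also have "\<dots> = ?e"
      by (rule push_stable_class[OF O(2,4) O(1) eps y(1) y1(1) y(2)])
    finally show ?thesis by (simp add: y1(2))
  qed
  note M = stable_Cmp_eqI[OF O(1) S_Obj[OF O(2)] O(4) e ne E(2) E(1) Sy c, folded m_def]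
  have M': "m \<subseteq> Hom \<C> X (S Y')" "m \<noteq> {}"
    using stable_morphismD[OF O(1) S_Obj[OF O(4)] M(1)] by blast+
  have X': "x \<subseteq> Hom \<C> X' X" "x \<noteq> {}"
    using stable_morphismD[OF O(3,1) x(1)] by blast+
  have n: "pull \<C> X' X Y' f (pull \<C> X (S Y') Y' g (\<sigma> Y')) = pull \<C> X' X Y' x\<^sub>0 ?e"
    if "g \<in> m" "f \<in> x" for g f
    using pull_stable_class[OF O(3,1,4) e x(1) \<open>f \<in> x\<close> x(2)] ext_of_eq[OF O(1,4) M(1) \<open>g \<in> m\<close>] M(2)
    by simp
  note L = stable_Cmp_eqI[OF O(3,1,4) pull_closed[OF O(3,1,4) x0 e] M'(2) X'(2,1) M'(1) n]
  show "\<epsilon>' \<in> Hom (stable_category \<C>) X' (S Y')"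
    unfolding \<epsilon>'_def ext1_map_def by (rule L(1)[unfolded m_def])
  have "pull \<C> X' X Y' x\<^sub>0 ?e = ExtMap \<C> X Y X' Y' x\<^sub>0 y\<^sub>0 (ext_of X Y \<epsilon>)"
    using O x0 y0 eps by (simp add: pull_push ExtMap_push_pull)
  then show "ext_of X' Y' \<epsilon>' = ExtMap \<C> X Y X' Y' x\<^sub>0 y\<^sub>0 (ext_of X Y \<epsilon>)"
    unfolding \<epsilon>'_def ext1_map_def using L(2)[unfolded m_def] by (simp only:)
qed

lemma natural_duality_stable_iff_Ext:
  "natural_duality K (Obj \<C>) (Hom (stable_category \<C>)) (\<lambda>X Y. Mor (stable_category \<C>) X (S Y))
      (ext1_map (stable_category \<C>) S (suspension_map \<C> S \<sigma>)) \<longleftrightarrow>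
   natural_duality K (Obj \<C>) (Hom \<C>) (Ext \<C>) (ExtMap \<C>)" (is "?stable \<longleftrightarrow> ?ext")
proof
  let ?inv = "\<lambda>X Y. inv_into (Hom (stable_category \<C>) X (S Y)) (ext_of X Y)"
  let ?cls = "\<lambda>X Y f. stable_ideal \<C> X Y +>\<^bsub>Mor \<C> X Y\<^esub> f"
  assume ?stable
  then show ?ext
  proof (rule natural_duality_transport[where \<Psi> = ?inv and t = ?cls])
    fix X Y assume XY: "X \<in> Obj \<C>" "Y \<in> Obj \<C>"
    show M: "module K (Mor (stable_category \<C>) X (S Y))"
      by (rule stable_module) (use XY in auto)
    show "module K (Ext \<C> X Y)"
      by (rule Ext_module[OF XY])
    show "linear_iso K (Ext \<C> X Y) (Mor (stable_category \<C>) X (S Y)) (?inv X Y)"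
      by (rule linear_iso_inv_into[OF M linear_iso_ext_of[OF XY]])
  next
    fix X X' x assume "X \<in> Obj \<C>" "X' \<in> Obj \<C>" "x \<in> Hom \<C> X' X"
    then show "?cls X' X x \<in> Hom (stable_category \<C>) X' X"
      by (intro stable_class_in_Hom)
  next
    fix X Y X' Y' x y e
    assume O: "X \<in> Obj \<C>" "Y \<in> Obj \<C>" "X' \<in> Obj \<C>" "Y' \<in> Obj \<C>"
      and xy: "x \<in> Hom \<C> X' X" "y \<in> Hom \<C> Y Y'" and e: "e \<in> carrier (Ext \<C> X Y)"
    show "ExtMap \<C> X Y X' Y' x y e \<in> carrier (Ext \<C> X' Y')"
      by (rule linear_map_closed[OF ExtMap_linear[OF O xy] e])
    have bij: "bij_betw (ext_of X Y) (Hom (stable_category \<C>) X (S Y)) (carrier (Ext \<C> X Y))"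
      "bij_betw (ext_of X' Y') (Hom (stable_category \<C>) X' (S Y')) (carrier (Ext \<C> X' Y'))"
      using linear_iso_ext_of O by (auto simp: linear_iso_def)
    have \<epsilon>: "?inv X Y e \<in> Hom (stable_category \<C>) X (S Y)" "ext_of X Y (?inv X Y e) = e"
      using bij(1) e by (auto simp: bij_betw_def inv_into_into f_inv_into_f)
    note m = ext_of_ext1_map[OF O stable_class_in_Hom[OF O(3,1) xy(1)] mem_stable_class[OF O(3,1) xy(1)]
        stable_class_in_Hom[OF O(2,4) xy(2)] mem_stable_class[OF O(2,4) xy(2)] \<epsilon>(1)]
    show "?inv X' Y' (ExtMap \<C> X Y X' Y' x y e) =
      ext1_map (stable_category \<C>) S (suspension_map \<C> S \<sigma>) X Y X' Y' (?cls X' X x) (?cls Y Y' y)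
        (?inv X Y e)"
      using bij(2) m \<epsilon>(2) by (intro inv_into_f_eq) (auto simp: bij_betw_def)
  qed
next
  \<comment> \<open>In this direction stable classes are translated back by choosing any member;
    \<open>ext_of_ext1_map\<close> holds for every choice.\<close>
  let ?rep = "\<lambda>X Y \<phi>. SOME f. f \<in> \<phi>"
  have rep: "?rep X Y \<phi> \<in> \<phi>" if "X \<in> Obj \<C>" "Y \<in> Obj \<C>" "\<phi> \<in> Hom (stable_category \<C>) X Y" for X Y \<phi>
    using stable_morphismD(1)[OF that] by (simp add: some_in_eq)
  assume ?ext
  then show ?stable
  proof (rule natural_duality_transport[where \<Psi> = ext_of and t = ?rep])
    fix X Y assume XY: "X \<in> Obj \<C>" "Y \<in> Obj \<C>"
    show "module K (Mor (stable_category \<C>) X (S Y))"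
      by (rule stable_module) (use XY in auto)
    show "module K (Ext \<C> X Y)"
      by (rule Ext_module[OF XY])
    show "linear_iso K (Mor (stable_category \<C>) X (S Y)) (Ext \<C> X Y) (ext_of X Y)"
      by (rule linear_iso_ext_of[OF XY])
  next
    fix X X' x assume "X \<in> Obj \<C>" "X' \<in> Obj \<C>" "x \<in> Hom (stable_category \<C>) X' X"
    then show "?rep X' X x \<in> Hom \<C> X' X"
      using rep stable_morphismD(2) by blast
  next
    fix X Y X' Y' x y \<epsilon>
    assume O: "X \<in> Obj \<C>" "Y \<in> Obj \<C>" "X' \<in> Obj \<C>" "Y' \<in> Obj \<C>"
      and xy: "x \<in> Hom (stable_category \<C>) X' X" "y \<in> Hom (stable_category \<C>) Y Y'"
      and \<epsilon>: "\<epsilon> \<in> Hom (stable_category \<C>) X (S Y)"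
    note m = ext_of_ext1_map[OF O xy(1) rep[OF O(3,1) xy(1)] xy(2) rep[OF O(2,4) xy(2)] \<epsilon>]
    show "ext1_map (stable_category \<C>) S (suspension_map \<C> S \<sigma>) X Y X' Y' x y \<epsilon> \<in>
        Hom (stable_category \<C>) X' (S Y')"
      by (rule m(1))
    show "ext_of X' Y' (ext1_map (stable_category \<C>) S (suspension_map \<C> S \<sigma>) X Y X' Y' x y \<epsilon>) =
        ExtMap \<C> X Y X' Y' (?rep X' X x) (?rep Y Y' y) (ext_of X Y \<epsilon>)"
      by (rule m(2))
  qed
qed

end

lemma stably_2CY_iff:
  assumes "frobenius_extriangulated_category K \<C>"
  shows "stably_2CY_frobenius K \<C> \<longleftrightarrow>
    (\<forall>A\<in>Obj \<C>. \<forall>B\<in>Obj \<C>. finite_dimensional K (Mor (stable_category \<C>) A B)) \<and>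
    natural_duality K (Obj \<C>) (Hom \<C>) (Ext \<C>) (ExtMap \<C>)"
proof -
  interpret frobenius_extriangulated_category K \<C> by fact
  have iff: "two_calabi_yau K (stable_category \<C>) S (suspension_map \<C> S \<sigma>) \<longleftrightarrow>
      (\<forall>A\<in>Obj \<C>. \<forall>B\<in>Obj \<C>. finite_dimensional K (Mor (stable_category \<C>) A B)) \<and>
      natural_duality K (Obj \<C>) (Hom \<C>) (Ext \<C>) (ExtMap \<C>)" if s: "suspension \<C> S \<sigma>" for S \<sigma>
  proof -
    interpret suspended_frobenius K \<C> S \<sigma> by unfold_locales (rule s)
    show ?thesis
      unfolding two_calabi_yau_iff_natural_duality stable_category_simps(1)
        natural_duality_stable_iff_Ext ..
  qed
  \<comment> \<open>Needed to produce some suspension from the suspension-free side. Object and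
    extension are chosen together as a pair, since both must come from one conflation.\<close>
  have "\<exists>S\<sigma>. \<exists>i I p. injective \<C> I \<and> realises \<C> X i I p (fst S\<sigma>) (snd S\<sigma>)" if "X \<in> Obj \<C>" for X
    using enough_injectives[OF that] by (fastforce simp: inflation_def conflation_def)
  then obtain S\<sigma> where
    "\<forall>X\<in>Obj \<C>. \<exists>i I p. injective \<C> I \<and> realises \<C> X i I p (fst (S\<sigma> X)) (snd (S\<sigma> X))"
    by metis
  then have "suspension \<C> (\<lambda>X. fst (S\<sigma> X)) (\<lambda>X. snd (S\<sigma> X))"
    by (simp add: suspension_def)
  with iff show ?thesis
    unfolding stably_2CY_frobenius_def using assms by blast
qed

section \<open>Extension-closed subcategories\<close>

lemma full_sub_simps [simp]:
  "Obj (full_sub \<C> \<D>) = \<D>"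
  "Mor (full_sub \<C> \<D>) = Mor \<C>"
  "Idt (full_sub \<C> \<D>) = Idt \<C>"
  "Cmp (full_sub \<C> \<D>) = Cmp \<C>"
  "Ext (full_sub \<C> \<D>) = Ext \<C>"
  "ExtMap (full_sub \<C> \<D>) = ExtMap \<C>"
  "(f, B, g) \<in> Rlz (full_sub \<C> \<D>) C A \<delta> \<longleftrightarrow> (f, B, g) \<in> Rlz \<C> C A \<delta> \<and> B \<in> \<D>"
  by (simp_all add: full_sub_def)

lemma push_full_sub [simp]: "push (full_sub \<C> \<D>) = push \<C>"
  by (simp add: fun_eq_iff push_def)

lemma pull_full_sub [simp]: "pull (full_sub \<C> \<D>) = pull \<C>"
  by (simp add: fun_eq_iff pull_def)

lemma extension_morphism_full_sub [simp]:
  "extension_morphism (full_sub \<C> \<D>) = extension_morphism \<C>"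
  by (simp add: fun_eq_iff extension_morphism_def)

lemma is_isomorphism_full_sub [simp]: "is_isomorphism (full_sub \<C> \<D>) = is_isomorphism \<C>"
  by (simp add: fun_eq_iff is_isomorphism_def)

lemma equivalent_sequences_full_sub [simp]:
  "equivalent_sequences (full_sub \<C> \<D>) A C s t \<longleftrightarrow> equivalent_sequences \<C> A C s t"
  by (cases s; cases t) simp

lemma realises_full_sub:
  assumes "\<D> \<subseteq> Obj \<C>"
  shows "realises (full_sub \<C> \<D>) A f B g C \<delta> \<longleftrightarrow>
    realises \<C> A f B g C \<delta> \<and> A \<in> \<D> \<and> B \<in> \<D> \<and> C \<in> \<D>"
  using assms by (auto simp: realises_def)

lemma is_biproduct_full_sub:
  assumes "\<D> \<subseteq> Obj \<C>"
  shows "is_biproduct (full_sub \<C> \<D>) A B S i j p q \<longleftrightarrow>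
    is_biproduct \<C> A B S i j p q \<and> A \<in> \<D> \<and> B \<in> \<D> \<and> S \<in> \<D>"
  using assms by (auto simp: is_biproduct_def)

lemma right_perp_full_sub: "\<D> \<subseteq> Obj \<C> \<Longrightarrow> right_perp (full_sub \<C> \<D>) \<X> = right_perp \<C> \<X> \<inter> \<D>"
  by (auto simp: right_perp_def)

lemma left_perp_full_sub: "\<D> \<subseteq> Obj \<C> \<Longrightarrow> left_perp (full_sub \<C> \<D>) \<X> = left_perp \<C> \<X> \<inter> \<D>"
  by (auto simp: left_perp_def)

lemma right_approximation_full_sub [simp]:
  "right_approximation (full_sub \<C> \<D>) = right_approximation \<C>"
  by (simp add: fun_eq_iff right_approximation_def)

lemma left_approximation_full_sub [simp]:
  "left_approximation (full_sub \<C> \<D>) = left_approximation \<C>"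
  by (simp add: fun_eq_iff left_approximation_def)

text \<open>Extension-closure is what keeps biproducts (middle terms of split sequences),
  representatives of realisations, and the new object \<open>E\<close> of the octahedral axioms
  inside \<D>. A zero object is assumed separately because the empty set is also
  extension-closed.\<close>

lemma (in extriangulated_category) extriangulated_full_sub:
  assumes closed: "extension_closed \<C> \<D>" and zero: "Z \<in> \<D>" "is_zero_object \<C> Z"
  shows "extriangulated_category K (full_sub \<C> \<D>)"
proof -
  let ?D = "full_sub \<C> \<D>"
  have sub: "\<D> \<subseteq> Obj \<C>"
    using closed by (simp add: extension_closed_def)
  have in_Obj [simp]: "A \<in> Obj \<C>" if "A \<in> \<D>" for A
    using that sub by blast
  have mid: "B \<in> \<D>" if "realises \<C> A f B g C \<delta>" "A \<in> \<D>" "C \<in> \<D>" for A f B g C \<delta>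
    using closed that unfolding extension_closed_def conflation_def by blast
  note r = realises_full_sub[OF sub] and b = is_biproduct_full_sub[OF sub]
  interpret D: linear_category K ?D
    by (rule linear_category.intro)
      (simp_all add: field_K Mor_module Idt_in_Hom Cmp_linear_left Cmp_linear_right Cmp_Idt_right
        Cmp_Idt_left Cmp_assoc)
  interpret D: additive_category K ?D
  proof (intro additive_category.intro additive_category_axioms.intro D.linear_category_axioms)
    show "\<exists>Z. is_zero_object ?D Z"
      using zero sub by (auto simp: is_zero_object_def)
    fix A B assume "A \<in> Obj ?D" "B \<in> Obj ?D"
    moreover from this obtain S i j p q where S: "is_biproduct \<C> A B S i j p q"
      using ex_biproduct[of A B] by auto
    ultimately show "\<exists>S i j p q. is_biproduct ?D A B S i j p q"
      using mid[OF realises_split[OF S]] by (simp only: b full_sub_simps) blast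
  qed
  interpret D: extension_bifunctor K ?D
    by (intro extension_bifunctor.intro D.additive_category_axioms extension_bifunctor_axioms.intro)
      (simp_all add: Ext_module ExtMap_linear ExtMap_linear_left ExtMap_linear_right ExtMap_Idt
        ExtMap_Cmp)
  interpret D: additive_realisation K ?D
  proof (intro additive_realisation.intro D.extension_bifunctor_axioms
      additive_realisation_axioms.intro, goal_cases)
    case (1 C A \<delta>)
    then have CA: "C \<in> \<D>" "A \<in> \<D>" "C \<in> Obj \<C>" "A \<in> Obj \<C>" "\<delta> \<in> carrier (Ext \<C> C A)" by auto
    obtain s where s: "s \<in> sequences \<C> A C"
      "Rlz \<C> C A \<delta> = {t \<in> sequences \<C> A C. equivalent_sequences \<C> A C s t}"
      using Rlz_class[OF CA(3-5)] by blast
    obtain f B g where fBg: "s = (f, B, g)" by (cases s)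
    have "s \<in> Rlz \<C> C A \<delta>"
      using s equivalent_sequences_refl[OF s(1)] CA by simp
    then have "realises \<C> A f B g C \<delta>"
      using CA by (simp add: realises_def fBg)
    then have "B \<in> \<D>" using mid CA by blast
    then have s': "s \<in> sequences ?D A C"
      using s(1) by (simp add: fBg sequences_def)
    have "t \<in> Rlz ?D C A \<delta> \<longleftrightarrow> t \<in> sequences ?D A C \<and> equivalent_sequences ?D A C s t" for t
    proof -
      obtain f' B' g' where t: "t = (f', B', g')" by (cases t)
      show ?thesis
        unfolding t full_sub_simps(7) s(2) equivalent_sequences_full_sub
        using in_Obj[of B'] by (auto simp: sequences_def)
    qed
    with s' show ?case by blast
  next
    case (2 A f B g C \<delta> A' f' B' g' C' \<delta>' a c)
    then show ?case
      using realises_morphism[of A f B g C \<delta> A' f' B' g' C' \<delta>' a c] by (simp add: r)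
  next
    case (3 A C S i j p q)
    then show ?case
      using realises_split[of A C S i j p q] by (simp add: r b)
  next
    case (4 A f B g C \<delta> A' f' B' g' C' \<delta>' SA iA jA pA qA SB iB jB pB qB SC iC jC pC qC)
    then show ?case
      using realises_sum[of A f B g C \<delta> A' f' B' g' C' \<delta>' SA iA jA pA qA SB iB jB pB qB SC iC jC pC qC]
      by (simp add: r b)
  qed
  show ?thesis
  proof (intro extriangulated_category.intro D.additive_realisation_axioms
      extriangulated_category_axioms.intro, goal_cases)
    case (1 A f B g C \<delta> A' f' B' g' C' \<delta>' a b)
    then show ?case
      using ET3[of A f B g C \<delta> A' f' B' g' C' \<delta>' a b] by (simp add: r)
  next
    case (2 A f B g C \<delta> A' f' B' g' C' \<delta>' b c)
    then show ?case
      using ET3_op[of A f B g C \<delta> A' f' B' g' C' \<delta>' b c] by (simp add: r)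
  next
    case (3 A f B f' D \<delta> g C g' F \<delta>')
    then have *: "realises \<C> A f B f' D \<delta>" "realises \<C> B g C g' F \<delta>'"
      and D: "A \<in> \<D>" "B \<in> \<D>" "D \<in> \<D>" "C \<in> \<D>" "F \<in> \<D>"
      by (auto simp: r)
    obtain E d e h h' \<delta>'' where E: "d \<in> Hom \<C> D E" "e \<in> Hom \<C> E F"
      "realises \<C> A h C h' E \<delta>''" "h = Cmp \<C> A B C g f" "Cmp \<C> B C E h' g = Cmp \<C> B D E d f'"
      "Cmp \<C> C E F e h' = g'" "realises \<C> D d E e F (push \<C> F B D f' \<delta>')"
      "pull \<C> D E A d \<delta>'' = \<delta>" "push \<C> E A B f \<delta>'' = pull \<C> E F B e \<delta>'"
      using ET4[OF *] by blast
    have "E \<in> \<D>" by (rule mid[OF E(7) D(3,5)])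
    with E D show ?case
      by (intro exI[of _ E] exI[of _ d] exI[of _ e] exI[of _ h] exI[of _ h'] exI[of _ \<delta>''])
        (simp add: r)
  next
    case (4 D f' A f B \<delta> F g' g C \<delta>')
    then have *: "realises \<C> D f' A f B \<delta>" "realises \<C> F g' B g C \<delta>'"
      and D: "A \<in> \<D>" "B \<in> \<D>" "D \<in> \<D>" "C \<in> \<D>" "F \<in> \<D>"
      by (auto simp: r)
    obtain E d e h h' \<delta>'' where E: "d \<in> Hom \<C> D E" "e \<in> Hom \<C> E F"
      "realises \<C> E h' A h C \<delta>''" "h = Cmp \<C> A B C g f" "Cmp \<C> D E A h' d = f'"
      "Cmp \<C> E A B f h' = Cmp \<C> E F B g' e" "realises \<C> D d E e F (pull \<C> F B D g' \<delta>)"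
      "push \<C> C E F e \<delta>'' = \<delta>'" "push \<C> B D E d \<delta> = pull \<C> B C E g \<delta>''"
      using ET4_op[OF *] by blast
    have "E \<in> \<D>" by (rule mid[OF E(7) D(3,5)])
    with E D show ?case
      by (intro exI[of _ E] exI[of _ d] exI[of _ e] exI[of _ h] exI[of _ h'] exI[of _ \<delta>''])
        (simp add: r)
  qed
qed

text \<open>The identity of \<open>Z\<close> is zero, and pushing out along it both fixes \<delta>
  and annihilates it. This puts the zero object into every right perpendicular category.\<close>

lemma (in extension_bifunctor) Ext_zero_zero_object:
  assumes Z: "is_zero_object \<C> Z" and X: "X \<in> Obj \<C>"
  shows "Ext_zero \<C> X Z"
proof (rule Ext_zeroI[OF X])
  show ZO: "Z \<in> Obj \<C>" using Z by (simp add: is_zero_object_def)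
  fix \<delta> assume d: "\<delta> \<in> carrier (Ext \<C> X Z)"
  have I: "Idt \<C> Z = \<zero>\<^bsub>Mor \<C> Z Z\<^esub>"
    using Z ZO Idt_in_Hom[OF ZO] by (auto simp: is_zero_object_def)
  have "ExtMap \<C> X Z X Z (Idt \<C> X) \<zero>\<^bsub>Mor \<C> Z Z\<^esub> \<delta> = \<zero>\<^bsub>Ext \<C> X Z\<^esub>"
    by (rule linear_map_zero[OF Mor_module[OF ZO ZO] Ext_module[OF X ZO]
          ExtMap_linear_right[OF X ZO X ZO Idt_in_Hom[OF X] d]])
  then show "\<delta> = \<zero>\<^bsub>Ext \<C> X Z\<^esub>"
    using ExtMap_Idt[OF X ZO d] I by simp
qed

lemma (in extension_bifunctor) Ext_zero_symmetric:
  assumes "natural_duality K (Obj \<C>) (Hom \<C>) (Ext \<C>) (ExtMap \<C>)"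
    and "X \<in> Obj \<C>" "Y \<in> Obj \<C>" "Ext_zero \<C> Y X"
  shows "Ext_zero \<C> X Y"
proof -
  obtain \<eta> where "linear_iso K (Ext \<C> X Y) (dual_module K (Ext \<C> Y X)) (\<eta> X Y)"
    using assms(1-3) unfolding natural_duality_def by blast
  from linear_iso_zero_module[OF Ext_module[OF assms(2,3)] Ext_module[OF assms(3,2)] this assms(4)]
  show ?thesis .
qed

lemma natural_duality_subset:
  assumes "natural_duality K Ob H M act" and sub: "Ob' \<subseteq> Ob"
  shows "natural_duality K Ob' H M act"
proof -
  obtain \<eta> where \<eta>: "\<forall>X\<in>Ob. \<forall>Y\<in>Ob. linear_iso K (M X Y) (dual_module K (M Y X)) (\<eta> X Y)"
    and nat: "\<forall>X\<in>Ob. \<forall>Y\<in>Ob. \<forall>X'\<in>Ob. \<forall>Y'\<in>Ob. \<forall>x\<in>H X' X. \<forall>y\<in>H Y Y'.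
      \<forall>e\<in>carrier (M X Y). \<forall>e'\<in>carrier (M Y' X').
        \<eta> X' Y' (act X Y X' Y' x y e) e' = \<eta> X Y e (act Y' X' Y X y x e')"
    using assms(1) unfolding natural_duality_def by blast
  show ?thesis
    unfolding natural_duality_def
    by (intro exI[of _ \<eta>] conjI ballI) (simp_all add: subsetD[OF sub] \<eta> nat)
qed

section \<open>The perpendicular category of a rigid subcategory\<close>

locale rigid_in_2CY = frobenius_extriangulated_category K \<F>
  for K :: "'k ring" and \<F> :: "('k, 'o, 'm, 'e) extri" +
  fixes \<X>
  assumes fin_dim: "\<lbrakk>A \<in> Obj \<F>; B \<in> Obj \<F>\<rbrakk> \<Longrightarrow> finite_dimensional K (Mor (stable_category \<F>) A B)"
    and duality: "natural_duality K (Obj \<F>) (Hom \<F>) (Ext \<F>) (ExtMap \<F>)"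
    and ff: "functorially_finite \<F> \<X>"
    and rigid: "rigid \<F> \<X>"
begin

abbreviation \<Z> :: "'o set" where "\<Z> \<equiv> right_perp \<F> \<X>"

abbreviation sub :: "('k, 'o, 'm, 'e) extri" where "sub \<equiv> full_sub \<F> \<Z>"

lemma X_Obj: "\<X> \<subseteq> Obj \<F>"
  using ff by (simp add: functorially_finite_def)

lemma Z_Obj: "\<Z> \<subseteq> Obj \<F>"
  by (auto simp: right_perp_def)

lemma Ext_zero_commute: "\<lbrakk>A \<in> Obj \<F>; B \<in> Obj \<F>\<rbrakk> \<Longrightarrow> Ext_zero \<F> A B \<longleftrightarrow> Ext_zero \<F> B A"
  using Ext_zero_symmetric[OF duality] by blast

lemma left_perp_eq_right_perp: "\<Y> \<subseteq> Obj \<F> \<Longrightarrow> left_perp \<F> \<Y> = right_perp \<F> \<Y>"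
  unfolding left_perp_def right_perp_def using Ext_zero_commute by blast

lemmas left_perp_X = left_perp_eq_right_perp[OF X_Obj]

lemma closed: "extension_closed \<F> \<Z>"
  by (rule extension_closed_right_perp[OF X_Obj])

lemma extriangulated_sub: "extriangulated_category K sub"
proof -
  obtain Z where Z: "is_zero_object \<F> Z" using ex_zero_object by blast
  have "Z \<in> \<Z>"
    using Z X_Obj Ext_zero_zero_object[OF Z] by (auto simp: right_perp_def is_zero_object_def)
  from extriangulated_full_sub[OF closed this Z] show ?thesis .
qed

sublocale sub: extriangulated_category K sub
  by (rule extriangulated_sub)

lemma projective_sub_iff: "projective sub P \<longleftrightarrow> P \<in> \<Z> \<and> (\<forall>W\<in>\<Z>. Ext_zero \<F> P W)"
  by (simp add: sub.projective_iff_Ext_zero)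

lemma injective_sub_iff: "injective sub P \<longleftrightarrow> P \<in> \<Z> \<and> (\<forall>W\<in>\<Z>. Ext_zero \<F> W P)"
  by (simp add: sub.injective_iff_Ext_zero)

lemma projective_sub_iff_injective: "projective sub P \<longleftrightarrow> injective sub P"
  unfolding projective_sub_iff injective_sub_iff using Ext_zero_commute Z_Obj by blast

lemma frobenius_sub: "frobenius_extriangulated_category K sub"
proof (intro frobenius_extriangulated_category.intro extriangulated_sub
    frobenius_extriangulated_category_axioms.intro projective_sub_iff_injective)
  fix M assume "M \<in> Obj sub"
  then have M: "M \<in> \<Z>" by simp
  obtain Z w Q q \<epsilon> where Q: "Z \<in> \<Z>" "Q \<in> \<Z>" "realises \<F> Z w Q q M \<epsilon>" "\<forall>W\<in>\<Z>. Ext_zero \<F> Q W"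
    using right_perp_enough_projectives[OF ff rigid M] by blast
  have "realises sub Z w Q q M \<epsilon>"
    using Q M by (simp add: realises_full_sub[OF Z_Obj])
  moreover have "projective sub Q"
    unfolding projective_sub_iff using Q by blast
  ultimately show "\<exists>P g. projective sub P \<and> deflation sub P M g"
    unfolding deflation_def conflation_def by blast
  \<comment> \<open>The dual construction lives in the left perpendicular category; its
    identification with \<Z> brings the injectives into the same subcategory as the
    projectives.\<close>
  obtain Z' w' Q' q' \<epsilon>' where Q': "Z' \<in> \<Z>" "Q' \<in> \<Z>" "realises \<F> M q' Q' w' Z' \<epsilon>'"
    "\<forall>W\<in>\<Z>. Ext_zero \<F> W Q'"
    using left_perp_enough_injectives[OF ff rigid, of M] M unfolding left_perp_X by blast
  have "realises sub M q' Q' w' Z' \<epsilon>'"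
    using Q' M by (simp add: realises_full_sub[OF Z_Obj])
  moreover have "injective sub Q'"
    unfolding injective_sub_iff using Q' by blast
  ultimately show "\<exists>I f. injective sub I \<and> inflation sub M I f"
    unfolding inflation_def conflation_def by blast
qed

sublocale sub: frobenius_extriangulated_category K sub
  by (rule frobenius_sub)

text \<open>Every projective of \<F> is injective there, hence lies in \<Z>, and it stays projective
  in the subcategory. Equality cannot be expected, since objects of \<X> become projective
  too.\<close>

lemma stable_ideal_sub:
  assumes "A \<in> \<Z>" "B \<in> \<Z>"
  shows "stable_ideal \<F> A B \<subseteq> stable_ideal sub A B"
proof
  fix f assume "f \<in> stable_ideal \<F> A B"
  then obtain P u v where P: "projective \<F> P" "u \<in> Hom \<F> A P" "v \<in> Hom \<F> P B"
    and f: "f = Cmp \<F> A P B v u"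
    by (auto simp: stable_ideal_def)
  have "P \<in> Obj \<F>" using P(1) by (simp add: projective_def)
  then have "P \<in> \<Z>"
    using Ext_zero_injective[OF P(1)] X_Obj unfolding right_perp_def by blast
  then have "projective sub P"
    unfolding projective_sub_iff using Ext_zero_projective[OF P(1)] Z_Obj by blast
  then show "f \<in> stable_ideal sub A B"
    using P f projective_sub_iff_injective unfolding stable_ideal_def by auto
qed

lemma stably_2CY_sub: "stably_2CY_frobenius K sub"
  unfolding stably_2CY_iff[OF frobenius_sub]
proof (intro conjI ballI)
  fix A B assume "A \<in> Obj sub" "B \<in> Obj sub"
  then have Z: "A \<in> \<Z>" "B \<in> \<Z>" by auto
  then have AB: "A \<in> Obj \<F>" "B \<in> Obj \<F>" using Z_Obj by auto
  have "submodule (stable_ideal sub A B) K (Mor \<F> A B)"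
    using sub.submodule_stable_ideal[of A B] Z by simp
  \<comment> \<open>The larger ideal makes the stable Hom-space of the subcategory a quotient of the
    one in \<F>.\<close>
  from finite_dimensional_coarser_quotient[OF Mor_module[OF AB] submodule_stable_ideal[OF AB] this
      stable_ideal_sub[OF Z]] fin_dim[OF AB]
  show "finite_dimensional K (Mor (stable_category sub) A B)" by simp
next
  show "natural_duality K (Obj sub) (Hom sub) (Ext sub) (ExtMap sub)"
    using natural_duality_subset[OF duality Z_Obj] by simp
qed

section \<open>Approximations and cluster-tilting subcategories\<close>

lemma right_approximation_from_sub:
  assumes T: "\<T> \<subseteq> \<Z>" and fT: "functorially_finite sub \<T>" and A: "A \<in> Obj \<F>"
  shows "\<exists>T r. right_approximation \<F> \<T> T A r"
proof -
  obtain X i Z z \<epsilon> where X: "X \<in> \<X>" and Z: "Z \<in> \<Z>" and re: "realises \<F> X i Z z A \<epsilon>"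
    using left_perp_cover[OF ff rigid A] unfolding left_perp_X by blast
  note o = realisesD[OF re]
  obtain T r where "right_approximation \<F> \<T> T Z r"
    using fT Z by (auto simp: functorially_finite_def)
  then have r: "T \<in> \<T>" "r \<in> Hom \<F> T Z"
    and lift: "\<And>T' h. \<lbrakk>T' \<in> \<T>; h \<in> Hom \<F> T' Z\<rbrakk> \<Longrightarrow> \<exists>k\<in>Hom \<F> T' T. h = Cmp \<F> T' T Z r k"
    by (auto simp: right_approximation_def)
  have TO: "T' \<in> Obj \<F>" if "T' \<in> \<T>" for T' using that T Z_Obj by blast
  have "\<exists>k\<in>Hom \<F> T' T. h = Cmp \<F> T' T A (Cmp \<F> T Z A z r) k"
    if T': "T' \<in> \<T>" and h: "h \<in> Hom \<F> T' A" for T' h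
  proof -
    \<comment> \<open>Membership in \<Z> gives vanishing with \<open>X\<close> in the first
      argument, while lifting along \<open>z\<close> is obstructed by \<E>(T', X); symmetry bridges
      the two. The lift then factors through the approximation of \<open>Z\<close>.\<close>
    have "Ext_zero \<F> X T'"
      using T' T X by (auto simp: right_perp_def)
    then have "Ext_zero \<F> T' X"
      using Ext_zero_commute[OF TO[OF T'] o(1)] by blast
    then have "pull \<F> T' A X h \<epsilon> = \<zero>\<^bsub>Ext \<F> T' X\<^esub>"
      using pull_closed[OF TO[OF T'] A o(1) h o(6)] by simp
    then obtain h' where h': "h' \<in> Hom \<F> T' Z" "Cmp \<F> T' Z A z h' = h"
      using lift_through_deflation[OF re TO[OF T'] h] by blast
    obtain k where k: "k \<in> Hom \<F> T' T" "h' = Cmp \<F> T' T Z r k"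
      using lift[OF T' h'(1)] by blast
    show ?thesis
      using k h'(2) Cmp_assoc[OF TO[OF T'] TO[OF r(1)] o(2,3) k(1) r(2) o(5)]
      by (intro bexI[of _ k]) auto
  qed
  then have "right_approximation \<F> \<T> T A (Cmp \<F> T Z A z r)"
    using r Cmp_closed[OF TO[OF r(1)] o(2,3) r(2) o(5)] by (simp add: right_approximation_def)
  then show ?thesis by blast
qed

text \<open>The conflation A -> Z -> X reduces maps out of \<open>A\<close> to maps out of
  \<open>Z\<close>: the obstruction to extending along \<open>z\<close> lies in \<E>(X, T'), which
  vanishes directly because \<T> lies in \<Z>.\<close>

lemma left_approximation_from_sub:
  assumes T: "\<T> \<subseteq> \<Z>" and fT: "functorially_finite sub \<T>" and A: "A \<in> Obj \<F>"
  shows "\<exists>T l. left_approximation \<F> \<T> A T l"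
proof -
  obtain X i Z z \<epsilon> where X: "X \<in> \<X>" and Z: "Z \<in> \<Z>" and re: "realises \<F> A z Z i X \<epsilon>"
    using right_perp_hull[OF ff rigid A] by blast
  note o = realisesD[OF re]
  obtain T l where "left_approximation \<F> \<T> Z T l"
    using fT Z by (auto simp: functorially_finite_def)
  then have l: "T \<in> \<T>" "l \<in> Hom \<F> Z T"
    and lift: "\<And>T' h. \<lbrakk>T' \<in> \<T>; h \<in> Hom \<F> Z T'\<rbrakk> \<Longrightarrow> \<exists>k\<in>Hom \<F> T T'. h = Cmp \<F> Z T T' k l"
    by (auto simp: left_approximation_def)
  have TO: "T' \<in> Obj \<F>" if "T' \<in> \<T>" for T' using that T Z_Obj by blast
  have "\<exists>k\<in>Hom \<F> T T'. h = Cmp \<F> A T T' k (Cmp \<F> A Z T l z)"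
    if T': "T' \<in> \<T>" and h: "h \<in> Hom \<F> A T'" for T' h
  proof -
    have "Ext_zero \<F> X T'"
      using T' T X by (auto simp: right_perp_def)
    then have "push \<F> X A T' h \<epsilon> = \<zero>\<^bsub>Ext \<F> X T'\<^esub>"
      using push_closed[OF o(3) A TO[OF T'] h o(6)] by simp
    then obtain h' where h': "h' \<in> Hom \<F> Z T'" "Cmp \<F> A Z T' h' z = h"
      using extend_along_inflation[OF re TO[OF T'] h] by blast
    obtain k where k: "k \<in> Hom \<F> T T'" "h' = Cmp \<F> Z T T' k l"
      using lift[OF T' h'(1)] by blast
    show ?thesis
      using k h'(2) Cmp_assoc[OF A o(2) TO[OF l(1)] TO[OF T'] o(4) l(2) k(1)]
      by (intro bexI[of _ k]) auto
  qed
  then have "left_approximation \<F> \<T> A T (Cmp \<F> A Z T l z)"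
    using l Cmp_closed[OF A o(2) TO[OF l(1)] o(4) l(2)] by (simp add: left_approximation_def)
  then show ?thesis by blast
qed

text \<open>The perpendicular categories of \<T> inside \<Z> are those in \<F> intersected with
  \<Z>. As soon as \<T> contains \<X>, its right perpendicular category already lies in that of
  \<X>, and the intersection changes nothing.\<close>

lemma cluster_tilting_sub_iff:
  "cluster_tilting sub \<T> \<longleftrightarrow> cluster_tilting \<F> \<T> \<and> \<X> \<subseteq> \<T>"
proof (intro iffI)
  assume "cluster_tilting sub \<T>"
  then have fT: "functorially_finite sub \<T>"
    and l: "left_perp \<F> \<T> \<inter> \<Z> = \<T>" and r: "right_perp \<F> \<T> \<inter> \<Z> = \<T>"
    by (auto simp: cluster_tilting_def left_perp_full_sub[OF Z_Obj] right_perp_full_sub[OF Z_Obj])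
  have T: "\<T> \<subseteq> \<Z>" using r by blast
  then have TO: "\<T> \<subseteq> Obj \<F>" using Z_Obj by blast
  have "\<X> \<subseteq> left_perp \<F> \<T>"
    using T X_Obj by (auto simp: left_perp_def right_perp_def)
  \<comment> \<open>Rigidity places \<X> inside \<Z>, so \<X> lies in the left perpendicular
    category of \<T> computed in \<Z>, which is \<T> itself.\<close>
  then have XT: "\<X> \<subseteq> \<T>"
    using rigid l unfolding rigid_def by blast
  then have "right_perp \<F> \<T> \<subseteq> \<Z>"
    unfolding right_perp_def by blast
  then have "right_perp \<F> \<T> = \<T>" using r by blast
  moreover have "functorially_finite \<F> \<T>"
    unfolding functorially_finite_def
    using TO right_approximation_from_sub[OF T fT] left_approximation_from_sub[OF T fT] by blast
  ultimately show "cluster_tilting \<F> \<T> \<and> \<X> \<subseteq> \<T>"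
    using XT left_perp_eq_right_perp[OF TO] by (simp add: cluster_tilting_def)
next
  assume "cluster_tilting \<F> \<T> \<and> \<X> \<subseteq> \<T>"
  then have fT: "functorially_finite \<F> \<T>" and l: "left_perp \<F> \<T> = \<T>" and r: "right_perp \<F> \<T> = \<T>"
    and XT: "\<X> \<subseteq> \<T>"
    by (auto simp: cluster_tilting_def)
  have "right_perp \<F> \<T> \<subseteq> \<Z>"
    using XT unfolding right_perp_def by blast
  then have T: "\<T> \<subseteq> \<Z>" using r by simp
  \<comment> \<open>Approximations of objects of \<Z> taken in \<F> serve unchanged, because the
    subcategory is full.\<close>
  moreover have "functorially_finite sub \<T>"
    using fT T Z_Obj unfolding functorially_finite_def by auto
  ultimately show "cluster_tilting sub \<T>"
    using l r
    by (auto simp: cluster_tilting_def left_perp_full_sub[OF Z_Obj] right_perp_full_sub[OF Z_Obj])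
qed

end

theorem theorem1:
  fixes K :: "'k ring" and \<F> :: "('k, 'o, 'm, 'e) extri" and \<X> :: "'o set"
  assumes "stably_2CY_frobenius K \<F>"
    and "\<X> \<subseteq> Obj \<F>"
    and "functorially_finite \<F> \<X>"
    and "rigid \<F> \<X>"
  shows "extension_closed \<F> (right_perp \<F> \<X>) \<and>
    stably_2CY_frobenius K (full_sub \<F> (right_perp \<F> \<X>)) \<and>
    {\<T>. cluster_tilting (full_sub \<F> (right_perp \<F> \<X>)) \<T>} =
      {\<T>. cluster_tilting \<F> \<T> \<and> \<X> \<subseteq> \<T>}"
proof -
  have frob: "frobenius_extriangulated_category K \<F>"
    using assms(1) by (simp add: stably_2CY_frobenius_def)
  interpret rigid_in_2CY K \<F> \<X>
    using assms(1)[unfolded stably_2CY_iff[OF frob]] assms(3,4)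
    by (intro rigid_in_2CY.intro rigid_in_2CY_axioms.intro frob) blast+
  show ?thesis
    using closed stably_2CY_sub cluster_tilting_sub_iff by simp
qed

end
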